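(* Let $f\colon[0,\infty)\times\mathbb R\times\mathbb R^n\to\mathbb R^n$ satisfy: (a) for every $r>0$, $f$ is bounded and continuous when restricted to $[0,\infty)\times\mathbb R\times\{x\in\mathbb R^n: |x|\le r\}$; (b) for every $r>0$ there exist a modulus of continuity $\theta_r$ and a constant $L_r>0$ such that $|f(\tau,t_1,x_1)-f(\tau,t_2,x_2)|\le\theta_r(|t_1-t_2|)+L_r|x_1-x_2|$ for all $\tau\ge 0$, $t_1,t_2\in\mathbb R$ and $|x_1|,|x_2|\le r$; (c) for every $(t,x)\in\mathbb R\times\mathbb R^n$ the limit $\hat f(t,x):=\lim_{T\to\infty}\frac1T\int_0^T f(s,t,x)\,ds$ exists; (d) for every $r>0$, $\hat f(t,x)=\lim_{T\to\infty}\frac1T\int_\tau^{T+\tau} f(s,t,x)\,ds$ uniformly for $(\tau,t,x)\in[0,\infty)\times\mathbb R\times\{|x|\le r\}$. Let $\Omega$ be the hull of $\hat f$ and $\pi$ the skewproduct flow on $\Omega\times\mathbb R^n$ associated with $\hat f$. Assume the existence of a local attractor $\mathcal A$ for $\pi$ with $\Omega_{\mathcal A}=\Omega$ (i.e. $\mathcal A$ projects onto the whole $\Omega$), and let $\hat x\in\mathbb R^n$ be such that $(\hat f,\hat x)\in\mathcal U_{\mathcal A}$, the basin of attraction of $\mathcal A$. Then: (i) for all $\sigma>0$ and $\delta>0$ there exist $t_0=t_0(\sigma,\delta)>0$ and $\varepsilon_0=\varepsilon_0(\sigma,\delta)>0$ such that, if $0<\varepsilon<\varepsilon_0$, then $\tilde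 x_\varepsilon(t;0,\hat x)$ is defined on $[0,\infty)$ and $$\operatorname{dist}_{\mathbb R^n}\big(\tilde x_\varepsilon(t;0,\hat x),\,\mathcal A^{[\delta]}_{\hat f\cdot t}\big)\le\sigma\quad\text{for all } t\ge t_0;$$ or, equivalently, $x_\varepsilon(\tau;0,\hat x)$ is defined on $[0,\infty)$ and $\operatorname{dist}_{\mathbb R^n}\big(x_\varepsilon(\tau;0,\hat x),\,\mathcal A^{[\delta]}_{\hat f\cdot \varepsilon\tau}\big)\le\sigma$ for all $\tau\ge t_0/\varepsilon$. (ii) If, in addition, the map $\Omega\to\mathcal P_c(\mathbb R^n)$, $\omega\mapsto\mathcal A_\omega$, is continuous for the Hausdorff metric, then (i) also holds for $\delta=0$.
   Context: A modulus of continuity is a nondecreasing map $\theta\colon[0,\infty)\to[0,\infty]$ with $\lim_{r\to0^+}\theta(r)=0$. $|\cdot|$ is the Euclidean norm. Solutions: for $\varepsilon>0$, $x_\varepsilon(\tau;\tau^*,x^* )$ is the maximal solution of $dx/d\tau=\varepsilon f(\tau,\varepsilon\tau,x)$ with value $x^*$ at $\tau=\tau^*\ge0$, and $\tilde x_\varepsilon(t;t^*,x^* )$ is the maximal solution of $dx/dt=f(t/\varepsilon,t,x)$ with value $x^*$ at $t=t^*\ge 0$; so $\tilde x_\varepsilon(\varepsilon\tau;\varepsilon\tau^*,x^* )=x_\varepsilon(\tau;\tau^*,x^* )$. Hull and skewproduct flow: for $h\in C(\mathbb R\times\mathbb R^n,\mathbb R^n)$ and $s\in\mathbb R$, let $(h\cdot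 s)(t,x):=h(t+s,x)$. The hull $\Omega$ of $\hat f$ is the closure of $\{\hat f\cdot s: s\in\mathbb R\}$ in $C(\mathbb R\times\mathbb R^n,\mathbb R^n)$ for the compact-open topology; under (a)–(c) it is a compact metric space, for a fixed distance $d_\Omega$ inducing this topology, and $\sigma_{\hat f}(t,\omega):=\omega\cdot t$ is a continuous global flow on $\Omega$. Put $\mathfrak f(\omega,x):=\omega(0,x)$, and let $t\mapsto v(t;\omega,x)$ be the maximal solution of $dz/dt=\mathfrak f(\omega\cdot t,z)=\omega(t,z)$ with $v(0;\omega,x)=x$. The (possibly local) continuous skewproduct flow is $\pi(t;\omega,x):=(\omega\cdot t,v(t;\omega,x))$, defined on an open set $\mathcal O_\pi\subseteq\mathbb R\times\Omega\times\mathbb R^n$; write $\pi_t(\mathcal C):=\{\pi(t;\omega,x):(\omega,x)\in\mathcal C,\ (t,\omega,x)\in\mathcal O_\pi\}$. A set $\mathcal C\subseteq\Omega\times\mathbb R^n$ is $\pi$-invariant if $\mathbb R\times\mathcal C\subseteq\mathcal O_\pi$ and $\pi_t(\mathcal C)=\mathcal C$ for all $t\in\mathbb R$. Distances: in a metric space $Y$, $\operatorname{dist}_Y(y,\mathcal C)=\inf_{c\in\mathcal C}d_Y(y,c)$ and $\operatorname{dist}_Y(\mathcal C_1,\mathcal C_2)=\sup_{y\in\mathcal C_1}\operatorname{dist}_Y(y,\mathcal C_2)$ (Hausdorff semidistance); the Hausdorff distance of compact sets is $d^H_Y(\mathcal C_1,\mathcal C_2)=\max(\operatorname{dist}_Y(\mathcal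 C_1,\mathcal C_2),\operatorname{dist}_Y(\mathcal C_2,\mathcal C_1))$. On $\Omega\times\mathbb R^n$ use $\max(d_\Omega(\omega_1,\omega_2),|x_1-x_2|)$. $\mathcal P_c(\mathbb R^n)$ is the set of nonempty compact subsets of $\mathbb R^n$ with the Hausdorff distance. $\bar{\mathcal B}_\mu(\mathcal C)$ is the closure of $\mathcal B_\mu(\mathcal C)=\{y:\operatorname{dist}(y,\mathcal C)<\mu\}$. Local attractor: a nonempty compact $\pi$-invariant set $\mathcal A\subset\Omega\times\mathbb R^n$ for which there is $\mu>0$ with $[0,\infty)\times\bar{\mathcal B}_\mu(\mathcal A)\subseteq\mathcal O_\pi$ and $\lim_{t\to\infty}\operatorname{dist}_{\Omega\times\mathbb R^n}(\pi_t(\bar{\mathcal B}_\mu(\mathcal A)),\mathcal A)=0$. Its fibers are $\mathcal A_\omega:=\{x:(\omega,x)\in\mathcal A\}$ and its projection is $\Omega_{\mathcal A}:=\{\omega\in\Omega:\mathcal A_\omega\ne\emptyset\}$. Basin of attraction: an open set $\mathcal U\subseteq\Omega\times\mathbb R^n$ is an attraction open set for $\mathcal A$ if $[0,\infty)\times\mathcal U\subset\mathcal O_\pi$ and $\lim_{t\to\infty}\operatorname{dist}_{\Omega\times\mathbb R^n}(\pi_t(\mathcal K),\mathcal A)=0$ for every compact $\mathcal K\subset\mathcal U$. The basin of attraction $\mathcal U_{\mathcal A}$ is the union of all attraction open sets for $\mathcal A$. Inflated attractor: for $\delta\ge0$, $\mathcal A^{[\delta]}_\omega:=\bigcup_{d_\Omega(\omega,\bar\omega)\le\delta}\mathcal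 A_{\bar\omega}$; in particular $\mathcal A^{[0]}_\omega=\mathcal A_\omega$. *)

theory Defs
  imports "HOL-Analysis.Analysis"
begin

section \<open>Maximal solutions of initial value problems\<close>

text \<open>At an endpoint of \<open>I\<close> belonging to \<open>I\<close> the derivative is one-sided. The set \<open>D\<close> of
  admissible times is \<open>{0..}\<close> for the original equations, since their right-hand sides are only
  given for nonnegative first argument, and \<open>UNIV\<close> for the equations of the hull.\<close>

definition solution_on ::
  "(real \<Rightarrow> 'a \<Rightarrow> 'a) \<Rightarrow> real \<Rightarrow> 'a::real_normed_vector \<Rightarrow> real set \<Rightarrow> (real \<Rightarrow> 'a) \<Rightarrow> bool" where
  "solution_on g t0 x0 I x \<longleftrightarrow>
     is_interval I \<and> t0 \<in> I \<and> x t0 = x0 \<and>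
     (\<forall>t\<in>I. (x has_vector_derivative g t (x t)) (at t within I))"

definition maximal_solution ::
  "real set \<Rightarrow> (real \<Rightarrow> 'a \<Rightarrow> 'a) \<Rightarrow> real \<Rightarrow> 'a::real_normed_vector \<Rightarrow> real set \<Rightarrow> (real \<Rightarrow> 'a) \<Rightarrow> bool"
  where
  "maximal_solution D g t0 x0 I x \<longleftrightarrow>
     I \<subseteq> D \<and> solution_on g t0 x0 I x \<and>
     (\<forall>J y. J \<subseteq> D \<and> solution_on g t0 x0 J y \<and> I \<subseteq> J \<and> (\<forall>t\<in>I. y t = x t) \<longrightarrow> J = I)"

text \<open>The descriptions below are meant for right-hand sides that are continuous and locally
  Lipschitz in the state, where the maximal solution exists and is unique; \<open>max_sol\<close> is only
  meaningful for times in \<open>max_dom\<close>.\<close>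

definition max_dom ::
  "real set \<Rightarrow> (real \<Rightarrow> 'a \<Rightarrow> 'a) \<Rightarrow> real \<Rightarrow> 'a::real_normed_vector \<Rightarrow> real set" where
  "max_dom D g t0 x0 = (THE I. \<exists>x. maximal_solution D g t0 x0 I x)"

definition max_sol ::
  "real set \<Rightarrow> (real \<Rightarrow> 'a \<Rightarrow> 'a) \<Rightarrow> real \<Rightarrow> 'a \<Rightarrow> real \<Rightarrow> 'a::real_normed_vector" where
  "max_sol D g t0 x0 t = (THE y. \<exists>I x. maximal_solution D g t0 x0 I x \<and> t \<in> I \<and> y = x t)"

definition fast_rhs ::
  "(real \<Rightarrow> real \<Rightarrow> 'a \<Rightarrow> 'a) \<Rightarrow> real \<Rightarrow> real \<Rightarrow> 'a \<Rightarrow> 'a::real_normed_vector" where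
  "fast_rhs f \<epsilon> = (\<lambda>\<tau> x. \<epsilon> *\<^sub>R f \<tau> (\<epsilon> * \<tau>) x)"

definition slow_rhs ::
  "(real \<Rightarrow> real \<Rightarrow> 'a \<Rightarrow> 'a) \<Rightarrow> real \<Rightarrow> real \<Rightarrow> 'a \<Rightarrow> 'a::real_normed_vector" where
  "slow_rhs f \<epsilon> = (\<lambda>t x. f (t / \<epsilon>) t x)"


section \<open>Moduli of continuity\<close>

definition modulus_of_continuity :: "(real \<Rightarrow> ennreal) \<Rightarrow> bool" where
  "modulus_of_continuity \<theta> \<longleftrightarrow> mono_on {0..} \<theta> \<and> (\<theta> \<longlongrightarrow> 0) (at_right 0)"


section \<open>Distances\<close>

text \<open>Values are taken in \<^typ>\<open>ennreal\<close>, so that suprema over unbounded sets and infima over the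
  empty set are \<open>\<infinity>\<close> and the supremum over the empty set is \<open>0\<close>. (In contrast,
  \<^const>\<open>infdist\<close> assigns distance \<open>0\<close> to the empty set.) The metric is a parameter because
  the hull is not a type.\<close>

definition dist_to :: "('y \<Rightarrow> 'y \<Rightarrow> real) \<Rightarrow> 'y \<Rightarrow> 'y set \<Rightarrow> ennreal" where
  "dist_to d y C = (INF c\<in>C. ennreal (d y c))"

definition semidist :: "('y \<Rightarrow> 'y \<Rightarrow> real) \<Rightarrow> 'y set \<Rightarrow> 'y set \<Rightarrow> ennreal" where
  "semidist d C1 C2 = (SUP y\<in>C1. dist_to d y C2)"

text \<open>Used for nonempty compact sets only, where the semidistances are finite.\<close>

definition hausdorff_dist :: "('y \<Rightarrow> 'y \<Rightarrow> real) \<Rightarrow> 'y set \<Rightarrow> 'y set \<Rightarrow> real" where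
  "hausdorff_dist d C1 C2 = enn2real (max (semidist d C1 C2) (semidist d C2 C1))"

definition compacts_topology :: "'a::metric_space set topology" where
  "compacts_topology = Metric_space.mtopology {K. compact K \<and> K \<noteq> {}} (hausdorff_dist dist)"

definition max_metric ::
  "('w \<Rightarrow> 'w \<Rightarrow> real) \<Rightarrow> 'w \<times> 'a::metric_space \<Rightarrow> 'w \<times> 'a \<Rightarrow> real" where
  "max_metric d = (\<lambda>(\<omega>1, x1) (\<omega>2, x2). max (d \<omega>1 \<omega>2) (dist x1 x2))"


section \<open>Hull and skewproduct flow\<close>

text \<open>The underlying set of the topology below consists of the continuous functions (take \<open>K = {}\<close>).\<close>

definition compact_open_topology :: "('a::topological_space \<Rightarrow> 'b::topological_space) topology" where
  "compact_open_topology =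
     topology_generated_by {{h. continuous_on UNIV h \<and> h ` K \<subseteq> U} |K U. compact K \<and> open U}"

type_synonym 'a field = "real \<times> 'a \<Rightarrow> 'a"

definition shift :: "'a field \<Rightarrow> real \<Rightarrow> 'a field" where
  "shift h s = (\<lambda>(t, x). h (t + s, x))"

definition field_hull :: "'a::real_normed_vector field \<Rightarrow> 'a field set" where
  "field_hull h = compact_open_topology closure_of (range (shift h))"

definition hull_topology :: "'a::real_normed_vector field set \<Rightarrow> 'a field topology" where
  "hull_topology \<Omega> = subtopology compact_open_topology \<Omega>"

definition phase_topology :: "'a::real_normed_vector field set \<Rightarrow> ('a field \<times> 'a) topology" where
  "phase_topology \<Omega> = prod_topology (hull_topology \<Omega>) euclidean"

definition base_field :: "'a field \<Rightarrow> 'a \<Rightarrow> 'a" where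
  "base_field \<omega> x = \<omega> (0, x)"

definition hull_rhs :: "'a field \<Rightarrow> real \<Rightarrow> 'a \<Rightarrow> 'a" where
  "hull_rhs \<omega> = (\<lambda>t z. base_field (shift \<omega> t) z)"

definition skew_dom :: "'a::real_normed_vector field set \<Rightarrow> (real \<times> 'a field \<times> 'a) set" where
  "skew_dom \<Omega> = {(t, \<omega>, x). \<omega> \<in> \<Omega> \<and> t \<in> max_dom UNIV (hull_rhs \<omega>) 0 x}"

definition skew_flow :: "real \<Rightarrow> 'a::real_normed_vector field \<times> 'a \<Rightarrow> 'a field \<times> 'a" where
  "skew_flow t = (\<lambda>(\<omega>, x). (shift \<omega> t, max_sol UNIV (hull_rhs \<omega>) 0 x t))"

definition skew_image ::
  "'a::real_normed_vector field set \<Rightarrow> real \<Rightarrow> ('a field \<times> 'a) set \<Rightarrow> ('a field \<times> 'a) set" where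
  "skew_image \<Omega> t C = {skew_flow t p |p. p \<in> C \<and> (t, p) \<in> skew_dom \<Omega>}"

definition skew_invariant ::
  "'a::real_normed_vector field set \<Rightarrow> ('a field \<times> 'a) set \<Rightarrow> bool" where
  "skew_invariant \<Omega> C \<longleftrightarrow> UNIV \<times> C \<subseteq> skew_dom \<Omega> \<and> (\<forall>t. skew_image \<Omega> t C = C)"


section \<open>Local attractors\<close>

text \<open>In this section \<open>d\<close> is the distance on the hull \<open>\<Omega>\<close>.\<close>

definition open_nbhd ::
  "'a::real_normed_vector field set \<Rightarrow> ('a field \<Rightarrow> 'a field \<Rightarrow> real) \<Rightarrow> real \<Rightarrow>
   ('a field \<times> 'a) set \<Rightarrow> ('a field \<times> 'a) set" where
  "open_nbhd \<Omega> d \<mu> C = {p \<in> \<Omega> \<times> UNIV. dist_to (max_metric d) p C < ennreal \<mu>}"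

definition closed_nbhd ::
  "'a::real_normed_vector field set \<Rightarrow> ('a field \<Rightarrow> 'a field \<Rightarrow> real) \<Rightarrow> real \<Rightarrow>
   ('a field \<times> 'a) set \<Rightarrow> ('a field \<times> 'a) set" where
  "closed_nbhd \<Omega> d \<mu> C = phase_topology \<Omega> closure_of open_nbhd \<Omega> d \<mu> C"

definition attracts ::
  "'a::real_normed_vector field set \<Rightarrow> ('a field \<Rightarrow> 'a field \<Rightarrow> real) \<Rightarrow>
   ('a field \<times> 'a) set \<Rightarrow> ('a field \<times> 'a) set \<Rightarrow> bool" where
  "attracts \<Omega> d A C \<longleftrightarrow> ((\<lambda>t. semidist (max_metric d) (skew_image \<Omega> t C) A) \<longlongrightarrow> 0) at_top"

definition local_attractor ::
  "'a::real_normed_vector field set \<Rightarrow> ('a field \<Rightarrow> 'a field \<Rightarrow> real) \<Rightarrow>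
   ('a field \<times> 'a) set \<Rightarrow> bool" where
  "local_attractor \<Omega> d A \<longleftrightarrow>
     A \<noteq> {} \<and> compactin (phase_topology \<Omega>) A \<and> skew_invariant \<Omega> A \<and>
     (\<exists>\<mu>>0. {0..} \<times> closed_nbhd \<Omega> d \<mu> A \<subseteq> skew_dom \<Omega> \<and> attracts \<Omega> d A (closed_nbhd \<Omega> d \<mu> A))"

definition attraction_open_set ::
  "'a::real_normed_vector field set \<Rightarrow> ('a field \<Rightarrow> 'a field \<Rightarrow> real) \<Rightarrow>
   ('a field \<times> 'a) set \<Rightarrow> ('a field \<times> 'a) set \<Rightarrow> bool" where
  "attraction_open_set \<Omega> d A U \<longleftrightarrow>
     openin (phase_topology \<Omega>) U \<and> {0..} \<times> U \<subseteq> skew_dom \<Omega> \<and>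
     (\<forall>K. compactin (phase_topology \<Omega>) K \<and> K \<subseteq> U \<longrightarrow> attracts \<Omega> d A K)"

definition basin_of_attraction ::
  "'a::real_normed_vector field set \<Rightarrow> ('a field \<Rightarrow> 'a field \<Rightarrow> real) \<Rightarrow>
   ('a field \<times> 'a) set \<Rightarrow> ('a field \<times> 'a) set" where
  "basin_of_attraction \<Omega> d A = \<Union>{U. attraction_open_set \<Omega> d A U}"

definition fiber :: "('w \<times> 'a) set \<Rightarrow> 'w \<Rightarrow> 'a set" where
  "fiber A \<omega> = {x. (\<omega>, x) \<in> A}"

definition base_projection :: "'w set \<Rightarrow> ('w \<times> 'a) set \<Rightarrow> 'w set" where
  "base_projection \<Omega> A = {\<omega> \<in> \<Omega>. fiber A \<omega> \<noteq> {}}"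

definition inflated_fiber ::
  "'w set \<Rightarrow> ('w \<Rightarrow> 'w \<Rightarrow> real) \<Rightarrow> ('w \<times> 'a) set \<Rightarrow> real \<Rightarrow> 'w \<Rightarrow> 'a set" where
  "inflated_fiber \<Omega> d A \<delta> \<omega> = (\<Union>\<omega>'\<in>{\<omega>' \<in> \<Omega>. d \<omega> \<omega>' \<le> \<delta>}. fiber A \<omega>')"

end

theory Submission
  imports Defs
begin

text \<open>On a time window of bounded length, solutions of the original equation stay uniformly close to
  solutions of the averaged equation driven by \<open>fhat\<close>, no matter where the window starts; this is
  a Gronwall estimate combined with freezing the slow variables on short pieces. Every hull solution
  starting within \<open>\<mu>\<close> of the attractor is bounded for all positive times and, after a time \<open>T\<close> that
  does not depend on the starting point, lies within \<open>\<eta> / 2\<close> of it. So if the pair consisting of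
  \<open>shift fhat a\<close> and the original solution at time \<open>a\<close> is within \<open>\<mu>\<close> of the attractor, then it is
  within \<open>\<eta> \<le> \<mu>\<close> throughout \<open>[a + T, a + 2 T]\<close>, and the argument restarts at \<open>a + T\<close>: neither
  stability of the attractor nor of the averaged equation enters. The hull is compact as the
  projection of the attractor.\<close>

section \<open>Perturbation of differential equations\<close>

text \<open>The obstacle is that nothing is known in advance about the size, or even the lifetime,
  of solutions of the original equation. They are therefore replaced by solutions of an equation
  truncated outside a ball, which exist for all time by a global fixed point argument. The radius of
  the ball is chosen from the averaged dynamics alone, with a margin of \<open>1\<close> for the
  averaging error; the tracking argument then shows that the truncation is never felt, and
  uniqueness identifies the truncated solution with the maximal one. The radius requires a bound on
  hull solutions that also covers the times before attraction sets in. It comes from comparison with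
  an orbit inside the attractor, which is bounded because the attractor is compact and invariant. In
  every window the comparison is with a fresh averaged solution that starts at the current value of
  the original one, so errors never accumulate. One bound on \<open>\<epsilon>\<close> serves all
  windows, because the mean values converge uniformly in the starting point of the fast time and in
  the slow time.\<close>

lemma nonincreasing_within:
  fixes u :: "real \<Rightarrow> real"
  assumes "a \<le> b"
    and der: "\<And>t. t \<in> {a..b} \<Longrightarrow> (u has_real_derivative u' t) (at t within {a..b})"
    and neg: "\<And>t. t \<in> {a..b} \<Longrightarrow> u' t \<le> 0"
  shows "u b \<le> u a"
proof (rule DERIV_nonpos_imp_decreasing_open[OF \<open>a \<le> b\<close>])
  show "\<exists>y. (u has_real_derivative y) (at x) \<and> y \<le> 0" if "a < x" "x < b" for x
    using der[of x] neg[of x] that at_within_Icc_at[of a x b] by auto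
  show "continuous_on {a..b} u"
    by (rule DERIV_continuous_on[OF der])
qed

text \<open>The integrating factor multiplies the majorant \<open>c + L * integral {a..t} u\<close>
  instead of \<open>u\<close>, which is merely continuous. The majorant is differentiable, and since
  \<open>u\<close> lies below it, its product with the factor cannot increase.\<close>

lemma gronwall:
  fixes u :: "real \<Rightarrow> real"
  assumes cont: "continuous_on {a..b} u" and L: "L \<ge> 0"
    and le: "\<And>t. t \<in> {a..b} \<Longrightarrow> u t \<le> c + L * integral {a..t} u"
    and t: "t \<in> {a..b}"
  shows "u t \<le> c * exp (L * (t - a))"
proof -
  define \<phi> where "\<phi> s = (c + L * integral {a..s} u) * exp (- (L * (s - a)))" for s
  define \<phi>' where "\<phi>' s = L * (u s - (c + L * integral {a..s} u)) * exp (- (L * (s - a)))" for s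
  have "\<phi> t \<le> \<phi> a"
  proof (rule nonincreasing_within[where u = \<phi> and u' = \<phi>'])
    show "a \<le> t" using t by simp
    fix s assume s: "s \<in> {a..t}"
    have c': "continuous_on {a..t} u"
      by (rule continuous_on_subset[OF cont]) (use t in auto)
    show "(\<phi> has_real_derivative \<phi>' s) (at s within {a..t})"
      unfolding \<phi>_def \<phi>'_def
      by (rule derivative_eq_intros integral_has_real_derivative[OF c' s] refl)+
         (simp add: algebra_simps)
    show "\<phi>' s \<le> 0"
      unfolding \<phi>'_def using le[of s] s t L
      by (intro mult_nonpos_nonneg mult_nonneg_nonpos) auto
  qed
  then have "(c + L * integral {a..t} u) * exp (- (L * (t - a))) \<le> c"
    by (simp add: \<phi>_def)
  then have "(c + L * integral {a..t} u) * exp (- (L * (t - a))) * exp (L * (t - a))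
      \<le> c * exp (L * (t - a))"
    by (rule mult_right_mono) simp
  then have "c + L * integral {a..t} u \<le> c * exp (L * (t - a))"
    by (simp add: mult.assoc flip: exp_add)
  then show ?thesis using le[OF t] by linarith
qed

text \<open>Only the time integral of the defect enters, not its pointwise size. Averaging depends
  on this: the difference between the fast field and its mean oscillates without becoming
  small.\<close>

lemma ode_perturbation:
  fixes z v :: "real \<Rightarrow> 'a::euclidean_space"
  assumes L: "L \<ge> 0"
    and z: "\<And>t. t \<in> {a..b} \<Longrightarrow> (z has_vector_derivative G t (z t)) (at t within {a..b})"
    and v: "\<And>t. t \<in> {a..b} \<Longrightarrow> (v has_vector_derivative h t) (at t within {a..b})"
    and lip: "\<And>t. t \<in> {a..b} \<Longrightarrow> norm (G t (z t) - G t (v t)) \<le> L * norm (z t - v t)"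
    and int: "(\<lambda>t. G t (v t)) integrable_on {a..b}"
    and defect: "\<And>t. t \<in> {a..b} \<Longrightarrow> norm (integral {a..t} (\<lambda>s. G s (v s) - h s)) \<le> \<rho>"
    and t: "t \<in> {a..b}"
  shows "norm (z t - v t) \<le> (norm (z a - v a) + \<rho>) * exp (L * (t - a))"
proof (rule gronwall[where u = "\<lambda>t. norm (z t - v t)" and b = b])
  have cz: "continuous_on {a..b} z" and cv: "continuous_on {a..b} v"
    using z v by (meson continuous_on_eq_continuous_within has_vector_derivative_continuous)+
  show cont: "continuous_on {a..b} (\<lambda>t. norm (z t - v t))"
    by (intro continuous_intros cz cv)
  fix s assume s: "s \<in> {a..b}"
  have sub: "{a..s} \<subseteq> {a..b}" using s by auto
  have iz: "((\<lambda>t. G t (z t)) has_integral (z s - z a)) {a..s}"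
    by (rule fundamental_theorem_of_calculus)
       (use s in \<open>auto intro!: has_vector_derivative_within_subset[OF z sub]\<close>)
  have iv: "(h has_integral (v s - v a)) {a..s}"
    by (rule fundamental_theorem_of_calculus)
       (use s in \<open>auto intro!: has_vector_derivative_within_subset[OF v sub]\<close>)
  have ig: "(\<lambda>t. G t (v t)) integrable_on {a..s}"
    by (rule integrable_subinterval_real[OF int sub])
  have iL: "(\<lambda>t. L * norm (z t - v t)) integrable_on {a..s}"
    by (intro integrable_continuous_real continuous_intros continuous_on_subset[OF cont sub])
  have "norm (integral {a..s} (\<lambda>t. G t (z t) - G t (v t))) \<le> integral {a..s} (\<lambda>t. L * norm (z t - v t))"
    by (rule integral_norm_bound_integral) (use iz ig iL lip s in \<open>auto intro: integrable_diff\<close>)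
  then have 1: "norm (integral {a..s} (\<lambda>t. G t (z t) - G t (v t))) \<le> L * integral {a..s} (\<lambda>t. norm (z t - v t))"
    by simp
  have e: "integral {a..s} (\<lambda>t. G t (z t) - G t (v t)) = (z s - z a) - integral {a..s} (\<lambda>t. G t (v t))"
    using iz ig by (simp add: integral_diff has_integral_integrable integral_unique)
  have e2: "integral {a..s} (\<lambda>s. G s (v s) - h s) = integral {a..s} (\<lambda>t. G t (v t)) - (v s - v a)"
    using iv ig by (simp add: integral_diff has_integral_integrable integral_unique)
  have "z s - v s = (z a - v a) + (integral {a..s} (\<lambda>t. G t (z t) - G t (v t))
      + integral {a..s} (\<lambda>s. G s (v s) - h s))"
    unfolding e e2 by simp
  then have "norm (z s - v s) \<le> norm (z a - v a) + (norm (integral {a..s} (\<lambda>t. G t (z t) - G t (v t)))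
      + norm (integral {a..s} (\<lambda>s. G s (v s) - h s)))"
    by (simp add: norm_triangle_le norm_triangle_mono order_trans[OF norm_triangle_ineq])
  then show "norm (z s - v s) \<le> norm (z a - v a) + \<rho> + L * integral {a..s} (\<lambda>t. norm (z t - v t))"
    using 1 defect[OF s] by linarith
qed (use L t in auto)

definition lipschitz_on_balls :: "real set \<Rightarrow> (real \<Rightarrow> 'a \<Rightarrow> 'a::real_normed_vector) \<Rightarrow> bool" where
  "lipschitz_on_balls D g \<longleftrightarrow> (\<forall>r. \<exists>L\<ge>0. \<forall>t\<in>D. \<forall>x y. norm x \<le> r \<and> norm y \<le> r \<longrightarrow>
     norm (g t x - g t y) \<le> L * norm (x - y))"

section \<open>Maximal solutions\<close>

text \<open>Both trajectories lie in one ball by compactness of the time interval, so a single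
  Lipschitz constant serves along both; the perturbation estimate with zero defect and zero initial
  error does the rest.\<close>

lemma solutions_agree_forward:
  fixes x y :: "real \<Rightarrow> 'a::euclidean_space"
  assumes lip: "lipschitz_on_balls D g" and ab: "a \<le> b" "{a..b} \<subseteq> D"
    and x: "\<And>t. t \<in> {a..b} \<Longrightarrow> (x has_vector_derivative g t (x t)) (at t within {a..b})"
    and y: "\<And>t. t \<in> {a..b} \<Longrightarrow> (y has_vector_derivative g t (y t)) (at t within {a..b})"
    and eq: "x a = y a"
  shows "x b = y b"
proof -
  have cx: "continuous_on {a..b} x" and cy: "continuous_on {a..b} y"
    using x y by (meson continuous_on_eq_continuous_within has_vector_derivative_continuous)+
  have "bounded (x ` {a..b} \<union> y ` {a..b})"
    using compact_continuous_image[OF cx] compact_continuous_image[OF cy]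
    by (simp add: compact_imp_bounded)
  then obtain r where r: "\<And>t. t \<in> {a..b} \<Longrightarrow> norm (x t) \<le> r \<and> norm (y t) \<le> r"
    unfolding bounded_iff by blast
  obtain L where L: "L \<ge> 0" "\<And>t u w. t \<in> D \<Longrightarrow> norm u \<le> r \<Longrightarrow> norm w \<le> r \<Longrightarrow>
     norm (g t u - g t w) \<le> L * norm (u - w)"
    using lip unfolding lipschitz_on_balls_def by meson
  have int: "(\<lambda>t. g t (y t)) integrable_on {a..b}"
    using fundamental_theorem_of_calculus[OF ab(1) y] by blast
  have "norm (x b - y b) \<le> (norm (x a - y a) + 0) * exp (L * (b - a))"
    by (rule ode_perturbation[where G = g and h = "\<lambda>t. g t (y t)", OF L(1) x y _ int])
       (use L(2) r ab in auto)
  then show ?thesis using eq by simp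
qed

text \<open>Gronwall runs forward only; reflecting time turns the backward problem into a forward
  one for the field \<open>- g (- t)\<close>.\<close>

lemma solutions_agree_backward:
  fixes x y :: "real \<Rightarrow> 'a::euclidean_space"
  assumes lip: "lipschitz_on_balls D g" and ab: "a \<le> b" "{a..b} \<subseteq> D"
    and x: "\<And>t. t \<in> {a..b} \<Longrightarrow> (x has_vector_derivative g t (x t)) (at t within {a..b})"
    and y: "\<And>t. t \<in> {a..b} \<Longrightarrow> (y has_vector_derivative g t (y t)) (at t within {a..b})"
    and eq: "x b = y b"
  shows "x a = y a"
proof -
  have lip': "lipschitz_on_balls (uminus ` D) (\<lambda>t z. - g (- t) z)"
    using lip unfolding lipschitz_on_balls_def by (simp add: norm_minus_commute)
  have refl: "((\<lambda>t. z (- t)) has_vector_derivative - g (- t) (z (- t))) (at t within {-b..-a})"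
    if z: "\<And>t. t \<in> {a..b} \<Longrightarrow> (z has_vector_derivative g t (z t)) (at t within {a..b})"
      and t: "t \<in> {-b..-a}" for z t
  proof -
    have "((z \<circ> uminus) has_vector_derivative (- 1) *\<^sub>R g (- t) (z (- t))) (at t within {-b..-a})"
      by (rule vector_diff_chain_within) (use z[of "-t"] t in \<open>auto intro!: derivative_eq_intros\<close>)
    then show ?thesis by (simp add: o_def)
  qed
  have sub: "{-b..-a} \<subseteq> uminus ` D"
    using image_mono[OF ab(2), of uminus] by simp
  have "x (- (- a)) = y (- (- a))"
    by (rule solutions_agree_forward[OF lip', where a = "-b" and b = "-a"
          and x = "\<lambda>t. x (- t)" and y = "\<lambda>t. y (- t)"])
       (use ab sub refl[OF x] refl[OF y] eq in auto)
  then show ?thesis by simp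
qed

lemma solution_on_subset:
  assumes "solution_on g t0 x0 I x" "J \<subseteq> I" "t \<in> J"
  shows "(x has_vector_derivative g t (x t)) (at t within J)"
  using assms unfolding solution_on_def
  by (meson has_vector_derivative_within_subset subsetD)

lemma solution_on_Icc_subset:
  assumes "solution_on g t0 x0 I x" "a \<in> I" "b \<in> I"
  shows "{a..b} \<subseteq> I"
  using assms unfolding solution_on_def
  by (meson atLeastAtMost_iff mem_is_interval_1_I subsetI)

lemma solution_on_unique:
  fixes x y :: "real \<Rightarrow> 'a::euclidean_space"
  assumes lip: "lipschitz_on_balls D g" and D: "I \<subseteq> D"
    and x: "solution_on g t0 x0 I x" and y: "solution_on g t0 x0 J y"
    and t: "t \<in> I" "t \<in> J"
  shows "x t = y t"
proof -
  have t0: "t0 \<in> I" "t0 \<in> J" "x t0 = y t0" using x y by (auto simp: solution_on_def)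
  consider "t0 \<le> t" | "t \<le> t0" by linarith
  then show ?thesis
  proof cases
    case 1
    note s = solution_on_Icc_subset[OF x t0(1) t(1)] solution_on_Icc_subset[OF y t0(2) t(2)]
    show ?thesis
      by (rule solutions_agree_forward[OF lip 1, where x = x and y = y])
         (use s D t0(3) in \<open>auto intro: solution_on_subset[OF x] solution_on_subset[OF y]\<close>)
  next
    case 2
    note s = solution_on_Icc_subset[OF x t(1) t0(1)] solution_on_Icc_subset[OF y t(2) t0(2)]
    show ?thesis
      by (rule solutions_agree_backward[OF lip 2, where x = x and y = y])
         (use s D t0(3) in \<open>auto intro: solution_on_subset[OF x] solution_on_subset[OF y]\<close>)
  qed
qed

text \<open>The punctured filter at an isolated point is trivial, so every vector is a derivative
  there. This makes the degenerate interval \<open>{t0}\<close> a legitimate domain of a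
  solution.\<close>

lemma has_vector_derivative_singleton: "(x has_vector_derivative d) (at t within {t})"
proof -
  have "at t within {t} = bot" by (simp add: at_within_eq_bot_iff)
  then show ?thesis
    unfolding has_vector_derivative_def has_derivative_within
    by (simp only: bounded_linear_scaleR_left tendsto_bot)
qed

lemma solution_on_trivial: "solution_on g t0 x0 {t0} (\<lambda>_. x0)"
  by (auto simp: solution_on_def is_interval_connected_1 has_vector_derivative_singleton)

text \<open>The derivative is taken relative to the domain, and a point may be an endpoint of one
  member of the family but interior to the union. Hence each one-sided derivative is obtained from a
  member that extends to that side, and the two are glued.\<close>

lemma solution_on_Union:
  fixes Y :: "real set \<Rightarrow> real \<Rightarrow> 'a::real_normed_vector"
  assumes ne: "\<S> \<noteq> {}"
    and sol: "\<And>J. J \<in> \<S> \<Longrightarrow> solution_on g t0 x0 J (Y J)"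
    and agree: "\<And>J t. J \<in> \<S> \<Longrightarrow> t \<in> J \<Longrightarrow> x t = Y J t"
  shows "solution_on g t0 x0 (\<Union>\<S>) x"
proof -
  have t0: "t0 \<in> J" if "J \<in> \<S>" for J using sol[OF that] by (simp add: solution_on_def)
  have "connected (\<Union>\<S>)"
  proof (rule connected_Union)
    show "connected J" if "J \<in> \<S>" for J
      using sol[OF that] by (simp add: solution_on_def is_interval_connected_1)
    show "\<Inter>\<S> \<noteq> {}" using t0 by blast
  qed
  then have int: "is_interval (\<Union>\<S>)" by (simp add: is_interval_connected_1)
  have x0: "x t0 = x0" "t0 \<in> \<Union>\<S>"
    using ne sol t0 agree by (fastforce simp: solution_on_def)+
  have der: "(x has_vector_derivative g t (x t)) (at t within \<Union>\<S>)" if t: "t \<in> \<Union>\<S>" for t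
  proof -
    have piece: "(x has_vector_derivative g t (x t)) (at t within {a..b})"
      if "J \<in> \<S>" "a \<in> J" "b \<in> J" "t \<in> {a..b}" for a b J
    proof -
      have sub: "{a..b} \<subseteq> J" by (rule solution_on_Icc_subset[OF sol[OF that(1)] that(2,3)])
      have e: "x s = Y J s" if "s \<in> {a..b}" for s
        using agree[OF \<open>J \<in> \<S>\<close>] sub that by blast
      have "(Y J has_vector_derivative g t (x t)) (at t within {a..b})"
        unfolding e[OF that(4)] by (rule solution_on_subset[OF sol[OF that(1)] sub that(4)])
      then show ?thesis
        by (rule has_vector_derivative_transform[OF that(4) e, rotated])
    qed
    have right: "(x has_vector_derivative g t (x t)) (at t within \<Union>\<S> \<inter> {t..})"
    proof (cases "\<Union>\<S> \<inter> {t..} \<subseteq> {t}")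
      case True
      then have "(x has_vector_derivative g t (x t)) (at t within \<Union>\<S> \<inter> {t..})
          \<longleftrightarrow> (x has_vector_derivative g t (x t)) (at t within {t})"
        using t by (intro arg_cong[of _ _ "\<lambda>A. (x has_vector_derivative g t (x t)) (at t within A)"]) auto
      then show ?thesis
        by (simp add: has_vector_derivative_singleton)
    next
      case False
      then obtain b where b: "b \<in> \<Union>\<S>" "t < b" by force
      \<comment> \<open>All members are intervals through \<open>t0\<close>. If
        \<open>t0 \<le> t\<close>, a member reaching the later point \<open>b\<close> passes through
        \<open>t\<close>; otherwise any member containing \<open>t\<close> already extends to the
        right, up to \<open>t0\<close>.\<close>
      obtain J c where J: "J \<in> \<S>" "t \<in> J" "c \<in> J" "t < c"
      proof (cases "t0 \<le> t")
        case True
        obtain J where "J \<in> \<S>" "b \<in> J" using b by auto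
        moreover have "t \<in> J"
          using solution_on_Icc_subset[OF sol[OF \<open>J \<in> \<S>\<close>] t0[OF \<open>J \<in> \<S>\<close>] \<open>b \<in> J\<close>] True b by auto
        ultimately show ?thesis using that b by blast
      next
        case False
        obtain J where "J \<in> \<S>" "t \<in> J" using t by auto
        then show ?thesis using that[of J t0] t0 False by auto
      qed
      have "c \<in> \<Union>\<S>" using J by auto
      then have "{t..c} \<subseteq> \<Union>\<S>"
        using int t by (meson atLeastAtMost_iff mem_is_interval_1_I subsetI)
      then have "at t within \<Union>\<S> \<inter> {t..} = at t within {t..c}"
        by (intro at_within_nhd[where S = "{..<c}"]) (use J in auto)
      then show ?thesis using piece[OF J(1,2,3)] J(4) by simp
    qed
    have left: "(x has_vector_derivative g t (x t)) (at t within \<Union>\<S> \<inter> {..t})"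
    proof (cases "\<Union>\<S> \<inter> {..t} \<subseteq> {t}")
      case True
      then have "(x has_vector_derivative g t (x t)) (at t within \<Union>\<S> \<inter> {..t})
          \<longleftrightarrow> (x has_vector_derivative g t (x t)) (at t within {t})"
        using t by (intro arg_cong[of _ _ "\<lambda>A. (x has_vector_derivative g t (x t)) (at t within A)"]) auto
      then show ?thesis
        by (simp add: has_vector_derivative_singleton)
    next
      case False
      then obtain b where b: "b \<in> \<Union>\<S>" "b < t" by force
      obtain J c where J: "J \<in> \<S>" "t \<in> J" "c \<in> J" "c < t"
      proof (cases "t \<le> t0")
        case True
        obtain J where "J \<in> \<S>" "b \<in> J" using b by auto
        moreover have "t \<in> J"
          using solution_on_Icc_subset[OF sol[OF \<open>J \<in> \<S>\<close>] \<open>b \<in> J\<close> t0[OF \<open>J \<in> \<S>\<close>]] True b by auto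
        ultimately show ?thesis using that b by blast
      next
        case False
        obtain J where "J \<in> \<S>" "t \<in> J" using t by auto
        then show ?thesis using that[of J t0] t0 False by auto
      qed
      have "c \<in> \<Union>\<S>" using J by auto
      then have "{c..t} \<subseteq> \<Union>\<S>"
        using int t by (meson atLeastAtMost_iff mem_is_interval_1_I subsetI)
      then have "at t within \<Union>\<S> \<inter> {..t} = at t within {c..t}"
        by (intro at_within_nhd[where S = "{c<..}"]) (use J in auto)
      then show ?thesis using piece[OF J(1,3,2)] J(4) by simp
    qed
    have "at t within \<Union>\<S> = sup (at t within \<Union>\<S> \<inter> {t..}) (at t within \<Union>\<S> \<inter> {..t})"
    proof -
      have "\<Union>\<S> = (\<Union>\<S> \<inter> {t..}) \<union> (\<Union>\<S> \<inter> {..t})" by auto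
      then show ?thesis by (subst at_within_union[symmetric]) simp
    qed
    then show ?thesis
      using left right unfolding has_vector_derivative_def has_derivative_within
      by (auto intro: filterlim_sup)
  qed
  show ?thesis using int x0 der by (simp add: solution_on_def)
qed

text \<open>Uniqueness alone suffices: the singleton \<open>{t0}\<close> already carries a solution, and the union of all
  solutions is the maximal one.\<close>

lemma max_sol_characterisation:
  fixes g :: "real \<Rightarrow> 'a \<Rightarrow> 'a::euclidean_space"
  assumes lip: "lipschitz_on_balls D g" and t0: "t0 \<in> D"
  shows "max_dom D g t0 x0 \<subseteq> D"
    and "solution_on g t0 x0 (max_dom D g t0 x0) (max_sol D g t0 x0)"
    and "\<And>J y. J \<subseteq> D \<Longrightarrow> solution_on g t0 x0 J y \<Longrightarrow>
           J \<subseteq> max_dom D g t0 x0 \<and> (\<forall>t\<in>J. max_sol D g t0 x0 t = y t)"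
proof -
  define \<S> where "\<S> = {J. J \<subseteq> D \<and> (\<exists>y. solution_on g t0 x0 J y)}"
  define Y where "Y J = (SOME y. solution_on g t0 x0 J y)" for J
  define x where "x t = Y (SOME J. J \<in> \<S> \<and> t \<in> J) t" for t
  have Y: "solution_on g t0 x0 J (Y J)" if "J \<in> \<S>" for J
    using that unfolding \<S>_def Y_def by (auto intro: someI[of "solution_on g t0 x0 J"])
  have agree: "x t = Y J t" if "J \<in> \<S>" "t \<in> J" for J t
  proof -
    have "(SOME J. J \<in> \<S> \<and> t \<in> J) \<in> \<S> \<and> t \<in> (SOME J. J \<in> \<S> \<and> t \<in> J)"
      by (rule someI) (use that in auto)
    then show ?thesis
      unfolding x_def using that
      by (intro solution_on_unique[OF lip _ Y Y]) (auto simp: \<S>_def)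
  qed
  have ne: "{t0} \<in> \<S>" using solution_on_trivial t0 by (auto simp: \<S>_def)
  have sol: "solution_on g t0 x0 (\<Union>\<S>) x"
    by (rule solution_on_Union[of _ _ _ _ Y]) (use ne Y agree in auto)
  have sub: "\<Union>\<S> \<subseteq> D" by (auto simp: \<S>_def)
  have max: "maximal_solution D g t0 x0 (\<Union>\<S>) x"
    unfolding maximal_solution_def using sol sub by (auto simp: \<S>_def)
  have below: "J \<subseteq> \<Union>\<S> \<and> (\<forall>t\<in>J. x t = y t)"
    if "J \<subseteq> D" "solution_on g t0 x0 J y" for J y
  proof -
    have "J \<in> \<S>" using that by (auto simp: \<S>_def)
    then show ?thesis using solution_on_unique[OF lip sub sol that(2)] by blast
  qed
  have uniq: "J = \<Union>\<S> \<and> (\<forall>t\<in>J. y t = x t)" if "maximal_solution D g t0 x0 J y" for J y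
  proof -
    have J: "J \<subseteq> D" "solution_on g t0 x0 J y" using that by (auto simp: maximal_solution_def)
    have "\<Union>\<S> = J"
      using that sub sol below[OF J] unfolding maximal_solution_def by blast
    then show ?thesis using below[OF J] by simp
  qed
  have dom: "max_dom D g t0 x0 = \<Union>\<S>"
    unfolding max_dom_def by (rule the_equality) (use max uniq in blast)+
  have val: "max_sol D g t0 x0 t = x t" if "t \<in> \<Union>\<S>" for t
    unfolding max_sol_def by (rule the_equality) (use max uniq that in blast)+
  show "max_dom D g t0 x0 \<subseteq> D" using dom sub by simp
  \<comment> \<open>\<open>max_sol\<close> agrees with \<open>x\<close> on the union only; elsewhere
    its definite description is unspecified. The derivative is therefore transferred within the
    domain.\<close>
  have der: "(max_sol D g t0 x0 has_vector_derivative g t (max_sol D g t0 x0 t)) (at t within \<Union>\<S>)"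
    if t: "t \<in> \<Union>\<S>" for t
  proof (rule has_vector_derivative_transform[OF t])
    show "(x has_vector_derivative g t (max_sol D g t0 x0 t)) (at t within \<Union>\<S>)"
      unfolding val[OF t] by (rule solution_on_subset[OF sol order_refl t])
    show "max_sol D g t0 x0 s = x s" if "s \<in> \<Union>\<S>" for s
      by (rule val[OF that])
  qed
  show "solution_on g t0 x0 (max_dom D g t0 x0) (max_sol D g t0 x0)"
    using sol val[of t0] der unfolding dom solution_on_def by simp
  show "J \<subseteq> max_dom D g t0 x0 \<and> (\<forall>t\<in>J. max_sol D g t0 x0 t = y t)"
    if "J \<subseteq> D" "solution_on g t0 x0 J y" for J y
  proof -
    have "max_sol D g t0 x0 t = y t" if "t \<in> J" for t
    proof -
      note b = below[OF \<open>J \<subseteq> D\<close> \<open>solution_on g t0 x0 J y\<close>]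
      have "t \<in> \<Union>\<S>" by (rule subsetD[OF conjunct1[OF b] that])
      from val[OF this] bspec[OF conjunct2[OF b] that] show ?thesis by (rule trans)
    qed
    then show ?thesis using below[OF that] unfolding dom by blast
  qed
qed

section \<open>Global solutions of truncated equations\<close>

lemma integral_has_vector_derivative_halfline:
  fixes h :: "real \<Rightarrow> 'a::banach"
  assumes cont: "continuous_on {0..} h" and t: "t \<ge> 0"
  shows "((\<lambda>u. integral {0..u} h) has_vector_derivative h t) (at t within {0..})"
proof -
  have "((\<lambda>u. integral {0..u} h) has_vector_derivative h t) (at t within {0..t+1})"
    by (rule integral_has_vector_derivative) (use t in \<open>auto intro: continuous_on_subset[OF cont]\<close>)
  moreover have "at t within {0..t+1} = at t within {0..}"
    by (rule at_within_nhd[where S = "{..<t+1}"]) auto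
  ultimately show ?thesis by simp
qed

text \<open>Picard iteration is a contraction on all of \<open>[0, \<infinity>)\<close> for the norm weighted by \<open>exp (- 2 L t)\<close>; below,
  \<open>y t = exp (- 2 L t) x t\<close> ranges over the bounded continuous functions.\<close>

lemma global_solution_exists:
  fixes g :: "real \<Rightarrow> 'a \<Rightarrow> 'a::euclidean_space"
  assumes L: "L > 0"
    and cont: "continuous_on ({0..} \<times> UNIV) (\<lambda>(t, x). g t x)"
    and lip: "\<And>t x y. t \<ge> 0 \<Longrightarrow> norm (g t x - g t y) \<le> L * norm (x - y)"
    and bound: "\<And>t x. t \<ge> 0 \<Longrightarrow> norm (g t x) \<le> M"
  obtains x where "solution_on g 0 x0 {0..} x"
proof -
  define h where "h y s = g s (exp (2 * L * s) *\<^sub>R apply_bcontfun y s)" for y s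
  \<comment> \<open>This is the integral equation for \<open>x\<close> multiplied by the weight.
    Bounded continuous functions live on the whole line, so \<open>max 0 t\<close> freezes
    everything for negative times.\<close>
  define N where "N y t = exp (- (2 * L * max 0 t)) *\<^sub>R (x0 + integral {0..max 0 t} (h y))" for y t
  have M: "M \<ge> 0" using bound[of 0 undefined] norm_ge_zero order_trans by blast
  have ch: "continuous_on {0..} (h y)" for y
  proof -
    have "continuous_on {0..} ((\<lambda>(t, x). g t x) \<circ> (\<lambda>s. (s, exp (2 * L * s) *\<^sub>R apply_bcontfun y s)))"
      by (intro continuous_on_compose continuous_intros continuous_on_subset[OF cont]) auto
    then show ?thesis by (simp add: o_def h_def)
  qed
  have ih: "h y integrable_on {0..t}" for y t
    by (intro integrable_continuous_real continuous_on_subset[OF ch]) auto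
  have cI: "continuous_on {0..} (\<lambda>u. integral {0..u} (h y))" for y
    using integral_has_vector_derivative_halfline[OF ch]
    by (meson atLeast_iff continuous_on_eq_continuous_within has_vector_derivative_continuous)
  have "N y \<in> bcontfun" for y
  proof (rule bcontfun_normI)
    have "continuous_on UNIV ((\<lambda>u. integral {0..u} (h y)) \<circ> (max 0))"
      by (intro continuous_on_compose continuous_intros continuous_on_subset[OF cI]) auto
    then show "continuous_on UNIV (N y)"
      unfolding N_def o_def by (intro continuous_intros)
    fix t :: real
    define s where "s = max 0 t"
    have s: "s \<ge> 0" by (simp add: s_def)
    have "norm (integral {0..s} (h y)) \<le> M * (s - 0)"
      by (rule integral_bound) (use s bound in \<open>auto simp: h_def intro: continuous_on_subset[OF ch[unfolded h_def]]\<close>)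
    then have "norm (x0 + integral {0..s} (h y)) \<le> norm x0 + M * s"
      using norm_triangle_ineq[of x0 "integral {0..s} (h y)"] by simp
    then have "norm (N y t) \<le> exp (- (2 * L * s)) * (norm x0 + M * s)"
      unfolding N_def s_def[symmetric] by simp
    also have "\<dots> \<le> norm x0 + M / (2 * L)"
    proof -
      have "exp (- (2 * L * s)) * norm x0 \<le> 1 * norm x0"
        by (intro mult_right_mono) (use L s in auto)
      \<comment> \<open>The integral grows at most linearly, which the weight absorbs; this keeps
        the iterate bounded.\<close>
      moreover have "exp (- (2 * L * s)) * (M * s) \<le> M / (2 * L)"
      proof -
        have "2 * L * s \<le> exp (2 * L * s)"
          using exp_ge_add_one_self[of "2 * L * s"] by linarith
        then have "exp (- (2 * L * s)) * (2 * L * s) \<le> 1"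
          by (simp add: exp_minus divide_simps)
        then have "M * (exp (- (2 * L * s)) * (2 * L * s)) \<le> M"
          using M by (simp add: mult_left_le)
        then show ?thesis using L by (simp add: field_simps)
      qed
      ultimately show ?thesis by (simp add: algebra_simps)
    qed
    finally show "norm (N y t) \<le> norm x0 + M / (2 * L)" .
  qed
  then have N: "apply_bcontfun (Bcontfun (N y)) = N y" for y
    by (simp add: Bcontfun_inverse)
  have "\<exists>!y. Bcontfun (N y) = y"
  proof (rule banach_fix_type[of "1/2"])
    show "\<forall>y y'. dist (Bcontfun (N y)) (Bcontfun (N y')) \<le> 1/2 * dist y y'"
    proof (intro allI dist_bound)
      fix y y' :: "real \<Rightarrow>\<^sub>C 'a" and t :: real
      define s where "s = max 0 t"
      define D where "D = dist y y'"
      have s: "s \<ge> 0" and D: "D \<ge> 0" by (auto simp: s_def D_def)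
      \<comment> \<open>Integrating \<open>L * exp (2 * L * r)\<close> returns the weight with a
        factor \<open>1/2\<close>. The exponent \<open>2 * L\<close> instead of \<open>L\<close> is
        what produces this contraction constant.\<close>
      have J: "((\<lambda>r. D / 2 * (2 * L * exp (2 * L * r))) has_integral
          (D / 2 * exp (2 * L * s) - D / 2 * exp (2 * L * 0))) {0..s}"
        by (rule fundamental_theorem_of_calculus[OF s])
           (auto intro!: derivative_eq_intros simp flip: has_real_derivative_iff_has_vector_derivative)
      have "norm (integral {0..s} (\<lambda>r. h y r - h y' r)) \<le> integral {0..s} (\<lambda>r. D / 2 * (2 * L * exp (2 * L * r)))"
      proof (rule integral_norm_bound_integral)
        fix r assume r: "r \<in> {0..s}"
        have "norm (h y r - h y' r) \<le> L * norm (exp (2 * L * r) *\<^sub>R y r - exp (2 * L * r) *\<^sub>R y' r)"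
          unfolding h_def by (rule lip) (use r in auto)
        also have "\<dots> = L * (exp (2 * L * r) * dist (y r) (y' r))"
          by (simp add: dist_norm flip: scaleR_right_diff_distrib)
        also have "\<dots> \<le> L * (exp (2 * L * r) * D)"
          unfolding D_def using L by (intro mult_left_mono dist_bounded) auto
        finally show "norm (h y r - h y' r) \<le> D / 2 * (2 * L * exp (2 * L * r))"
          by (simp add: algebra_simps)
      qed (use J ih in \<open>auto intro: integrable_diff\<close>)
      also have "\<dots> \<le> D / 2 * exp (2 * L * s)"
        unfolding integral_unique[OF J] using D by simp
      finally have *: "norm (integral {0..s} (h y) - integral {0..s} (h y')) \<le> D / 2 * exp (2 * L * s)"
        using ih by (simp add: integral_diff)
      have "dist (N y t) (N y' t) = exp (- (2 * L * s)) * norm (integral {0..s} (h y) - integral {0..s} (h y'))"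
        unfolding N_def s_def[symmetric] dist_norm by (simp flip: scaleR_right_diff_distrib)
      also have "\<dots> \<le> exp (- (2 * L * s)) * (D / 2 * exp (2 * L * s))"
        by (intro mult_left_mono *) auto
      also have "\<dots> = D / 2" by (simp add: exp_minus)
      finally show "dist (apply_bcontfun (Bcontfun (N y)) t) (apply_bcontfun (Bcontfun (N y')) t) \<le> 1/2 * dist y y'"
        unfolding N D_def by simp
    qed
  qed auto
  then obtain y where "Bcontfun (N y) = y" by blast
  then have y: "apply_bcontfun y = N y" using N by metis
  define x where "x t = exp (2 * L * t) *\<^sub>R apply_bcontfun y t" for t
  have hx: "h y s = g s (x s)" for s by (simp add: h_def x_def)
  have x: "x t = x0 + integral {0..t} (h y)" if "t \<ge> 0" for t
    unfolding x_def y N_def using that by (simp add: exp_minus)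
  have "(x has_vector_derivative g t (x t)) (at t within {0..})" if "t \<in> {0..}" for t
  proof (rule has_vector_derivative_transform[OF that])
    show "x s = x0 + integral {0..s} (h y)" if "s \<in> {0..}" for s using x that by auto
    show "((\<lambda>s. x0 + integral {0..s} (h y)) has_vector_derivative g t (x t)) (at t within {0..})"
      using integral_has_vector_derivative_halfline[OF ch, of t y] that
      by (auto intro!: derivative_eq_intros simp: hx)
  qed
  then have "solution_on g 0 x0 {0..} x"
    using x[of 0] by (simp add: solution_on_def is_interval_ci)
  then show ?thesis by (rule that)
qed

text \<open>Projection onto a ball is the truncation used throughout: being nonexpansive, it makes a
  Lipschitz bound on the ball global with the same constant, and it leaves the field unchanged
  inside.\<close>

lemma closest_point_cball:
  assumes "r \<ge> 0"
  shows "norm (closest_point (cball 0 r) x) \<le> r"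
    and "norm (closest_point (cball 0 r) x - closest_point (cball 0 r) y) \<le> norm (x - y)"
    and "norm x \<le> r \<Longrightarrow> closest_point (cball 0 r) x = x"
  using closest_point_in_set[of "cball 0 r" x] closest_point_lipschitz[of "cball 0 r" x y] assms
    closest_point_self[of x "cball 0 r"]
  by (auto simp: dist_norm)

lemma cutoff_solution_exists:
  fixes g :: "real \<Rightarrow> 'a \<Rightarrow> 'a::euclidean_space"
  assumes r: "r \<ge> 0" and L: "L \<ge> 0"
    and cont: "continuous_on ({0..} \<times> cball 0 r) (\<lambda>(t, x). g t x)"
    and lip: "\<And>t x y. t \<ge> 0 \<Longrightarrow> norm x \<le> r \<Longrightarrow> norm y \<le> r \<Longrightarrow> norm (g t x - g t y) \<le> L * norm (x - y)"
    and bound: "\<And>t x. t \<ge> 0 \<Longrightarrow> norm x \<le> r \<Longrightarrow> norm (g t x) \<le> M"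
  obtains x where "solution_on (\<lambda>t x. g t (closest_point (cball 0 r) x)) 0 x0 {0..} x"
proof (rule global_solution_exists[where g = "\<lambda>t x. g t (closest_point (cball 0 r) x)"
      and L = "L + 1" and M = M])
  note cp = closest_point_cball[OF r]
  \<comment> \<open>The exponential weight of the fixed point argument requires a strictly positive
    constant, whereas \<open>L\<close> may vanish.\<close>
  show "L + 1 > 0" using L by simp
  have "continuous_on ({0..} \<times> UNIV) ((\<lambda>(t, x). g t x) \<circ> (\<lambda>(t, x). (t, closest_point (cball 0 r) x)))"
    unfolding case_prod_unfold
    by (intro continuous_on_compose continuous_intros continuous_on_subset[OF cont[unfolded case_prod_unfold]]
        continuous_on_compose2[OF continuous_on_closest_point[of "cball 0 r" UNIV]])
       (use r cp(1) in auto)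
  then show "continuous_on ({0..} \<times> UNIV) (\<lambda>(t, x). g t (closest_point (cball 0 r) x))"
    by (simp add: o_def case_prod_unfold)
  show "norm (g t (closest_point (cball 0 r) x)) \<le> M" if "t \<ge> 0" for t x
    by (rule bound[OF that cp(1)])
  show "norm (g t (closest_point (cball 0 r) x) - g t (closest_point (cball 0 r) y)) \<le> (L + 1) * norm (x - y)"
    if "t \<ge> 0" for t x y
  proof -
    have "norm (g t (closest_point (cball 0 r) x) - g t (closest_point (cball 0 r) y))
        \<le> L * norm (closest_point (cball 0 r) x - closest_point (cball 0 r) y)"
      by (rule lip[OF that cp(1) cp(1)])
    also have "\<dots> \<le> L * norm (x - y)" by (intro mult_left_mono cp L)
    also have "\<dots> \<le> (L + 1) * norm (x - y)" by (simp add: mult_right_mono)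
    finally show ?thesis .
  qed
qed (use that in auto)

text \<open>The solution of the equation truncated at radius \<open>r + 1\<close> is globally Lipschitz-controlled, hence stays
  within \<open>1\<close> of \<open>w\<close>; it therefore never sees the truncation and coincides with \<open>v\<close>.\<close>

lemma solution_stays_bounded:
  fixes g :: "real \<Rightarrow> 'a \<Rightarrow> 'a::euclidean_space"
  assumes r: "r \<ge> 0" and T: "T \<ge> 0" and L: "L \<ge> 0" and \<eta>: "\<eta> \<ge> 0"
    and cont: "continuous_on ({0..} \<times> cball 0 (r + 1)) (\<lambda>(t, x). g t x)"
    and lip: "\<And>t x y. t \<ge> 0 \<Longrightarrow> norm x \<le> r + 1 \<Longrightarrow> norm y \<le> r + 1 \<Longrightarrow> norm (g t x - g t y) \<le> L * norm (x - y)"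
    and bound: "\<And>t x. t \<ge> 0 \<Longrightarrow> norm x \<le> r + 1 \<Longrightarrow> norm (g t x) \<le> M"
    and locally_lip: "lipschitz_on_balls {0..} g"
    and v: "\<And>t. t \<in> {0..T} \<Longrightarrow> (v has_vector_derivative g t (v t)) (at t within {0..T})"
    and w: "\<And>t. t \<in> {0..T} \<Longrightarrow> (w has_vector_derivative h t (w t)) (at t within {0..T})"
    and w_bound: "\<And>t. t \<in> {0..T} \<Longrightarrow> norm (w t) \<le> r"
    and defect: "\<And>t x. t \<in> {0..T} \<Longrightarrow> norm x \<le> r \<Longrightarrow> norm (g t x - h t x) \<le> \<eta>"
    and small: "(norm (v 0 - w 0) + \<eta> * T) * exp (L * T) \<le> 1"
    and t: "t \<in> {0..T}"
  shows "norm (v t) \<le> r + 1"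
proof -
  have r1: "r + 1 \<ge> 0" using r by simp
  note cp = closest_point_cball[OF r1]
  define G where "G t x = g t (closest_point (cball 0 (r + 1)) x)" for t x
  obtain z where z: "solution_on G 0 (v 0) {0..} z"
    using cutoff_solution_exists[OF r1 L cont lip bound] unfolding G_def by blast
  have z0: "z 0 = v 0" using z by (simp add: solution_on_def)
  \<comment> \<open>Truncation acts as the identity along \<open>w\<close>, so the defect there is
    the difference of the two original fields.\<close>
  have Gw: "G t (w t) = g t (w t)" if "t \<in> {0..T}" for t
    unfolding G_def using cp(3)[of "w t"] w_bound[OF that] by simp
  have zder: "(z has_vector_derivative G t (z t)) (at t within {0..T})" if "t \<in> {0..T}" for t
    by (rule solution_on_subset[OF z _ that]) auto
  have cw: "continuous_on {0..T} w"
    using w by (meson continuous_on_eq_continuous_within has_vector_derivative_continuous)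
  have "continuous_on {0..T} ((\<lambda>(t, x). g t x) \<circ> (\<lambda>t. (t, w t)))"
    by (intro continuous_on_compose continuous_intros cw continuous_on_subset[OF cont])
       (use w_bound in force)
  then have cGw: "continuous_on {0..T} (\<lambda>t. G t (w t))"
    using continuous_on_cong[OF refl Gw, of "{0..T}"] by (simp add: o_def)
  have close: "norm (z t - w t) \<le> 1" if t: "t \<in> {0..T}" for t
  proof -
    have "norm (z t - w t) \<le> (norm (z 0 - w 0) + \<eta> * T) * exp (L * (t - 0))"
    proof (rule ode_perturbation[where G = G and h = "\<lambda>t. h t (w t)" and b = T, OF L zder w])
      show "norm (G t (z t) - G t (w t)) \<le> L * norm (z t - w t)" if "t \<in> {0..T}" for t
      proof -
        have "norm (G t (z t) - G t (w t)) \<le> L * norm (closest_point (cball 0 (r + 1)) (z t) - closest_point (cball 0 (r + 1)) (w t))"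
          unfolding G_def by (rule lip) (use that cp in auto)
        also have "\<dots> \<le> L * norm (z t - w t)" by (intro mult_left_mono cp L)
        finally show ?thesis .
      qed
      show "(\<lambda>t. G t (w t)) integrable_on {0..T}"
        by (rule integrable_continuous_real[OF cGw])
      show "norm (integral {0..t} (\<lambda>s. G s (w s) - h s (w s))) \<le> \<eta> * T" if t: "t \<in> {0..T}" for t
      proof -
        have sub: "{0..t} \<subseteq> {0..T}" using t by auto
        have "(\<lambda>s. h s (w s)) integrable_on {0..T}"
          using fundamental_theorem_of_calculus[OF T w] by blast
        then have "(\<lambda>s. G s (w s) - h s (w s)) integrable_on {0..T}"
          using integrable_continuous_real[OF cGw] integrable_diff by blast
        then have "(\<lambda>s. G s (w s) - h s (w s)) integrable_on {0..t}"
          by (rule integrable_subinterval_real[OF _ sub])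
        then have "((\<lambda>s. G s (w s) - h s (w s)) has_integral integral {0..t} (\<lambda>s. G s (w s) - h s (w s))) {0..t}"
          by (rule integrable_integral)
        then have "norm (integral {0..t} (\<lambda>s. G s (w s) - h s (w s))) \<le> \<eta> * measure lborel {0..t}"
          using sub defect w_bound Gw by (intro has_integral_bound_real[OF \<eta> finite.emptyI]) auto
        also have "\<dots> \<le> \<eta> * T" using t \<eta> by (intro mult_left_mono) auto
        finally show ?thesis .
      qed
    qed (use t in auto)
    also have "\<dots> \<le> (norm (z 0 - w 0) + \<eta> * T) * exp (L * T)"
      using t L \<eta> T by (intro mult_left_mono) (auto intro!: mult_left_mono add_nonneg_nonneg)
    finally show ?thesis using small z0 by simp
  qed
  have zb: "norm (z t) \<le> r + 1" if "t \<in> {0..T}" for t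
    using close[OF that] w_bound[OF that] norm_triangle_sub[of "z t" "w t"] by linarith
  have zg: "(z has_vector_derivative g t (z t)) (at t within {0..T})" if "t \<in> {0..T}" for t
    using zder[OF that] cp(3)[OF zb[OF that]] unfolding G_def by simp
  have "v t = z t"
    by (rule solutions_agree_forward[OF locally_lip, where a = 0 and x = v and y = z])
       (use t z0 in \<open>auto intro: has_vector_derivative_within_subset[OF v] has_vector_derivative_within_subset[OF zg]\<close>)
  then show ?thesis using zb[OF t] by simp
qed

section \<open>Averaging on bounded time intervals\<close>

text \<open>The hypotheses in the form in which the estimates consume them: the modulus of
  continuity is split into a Lipschitz bound in the state and equicontinuity in the slow time, both
  uniform in the fast time. Radii range over all reals, which spares positivity conditions
  later.\<close>

locale averaging =
  fixes f :: "real \<Rightarrow> real \<Rightarrow> 'a \<Rightarrow> 'a::euclidean_space" and F :: "'a field"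
  assumes f_cont: "\<And>r. continuous_on ({0..} \<times> UNIV \<times> cball 0 r) (\<lambda>(\<tau>, t, x). f \<tau> t x)"
    and f_bound: "\<And>r. \<exists>M\<ge>0. \<forall>\<tau>\<ge>0. \<forall>t x. norm x \<le> r \<longrightarrow> norm (f \<tau> t x) \<le> M"
    and f_lip: "\<And>r. \<exists>L\<ge>0. \<forall>\<tau>\<ge>0. \<forall>t x y. norm x \<le> r \<and> norm y \<le> r \<longrightarrow>
          norm (f \<tau> t x - f \<tau> t y) \<le> L * norm (x - y)"
    and f_equi: "\<And>r \<eta>. \<eta> > 0 \<Longrightarrow> \<exists>h>0. \<forall>\<tau>\<ge>0. \<forall>t1 t2 x. \<bar>t1 - t2\<bar> < h \<and> norm x \<le> r \<longrightarrow>
          norm (f \<tau> t1 x - f \<tau> t2 x) \<le> \<eta>"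
    and mean: "\<And>r \<gamma>. \<gamma> > 0 \<Longrightarrow> \<exists>T0>0. \<forall>T\<ge>T0. \<forall>\<tau>\<ge>0. \<forall>t x. norm x \<le> r \<longrightarrow>
          norm ((1 / T) *\<^sub>R integral {\<tau>..T + \<tau>} (\<lambda>s. f s t x) - F (t, x)) \<le> \<gamma>"
begin

lemma f_continuous_along:
  assumes \<epsilon>: "\<epsilon> > 0" and S: "S \<subseteq> {0..}" and u: "continuous_on S u" and w: "continuous_on S w"
    and r: "\<And>s. s \<in> S \<Longrightarrow> norm (w s) \<le> r"
  shows "continuous_on S (\<lambda>s. f (s / \<epsilon>) (u s) (w s))"
proof -
  have "continuous_on S ((\<lambda>(\<tau>, t, x). f \<tau> t x) \<circ> (\<lambda>s. (s / \<epsilon>, u s, w s)))"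
    by (intro continuous_on_compose continuous_intros u w continuous_on_subset[OF f_cont[of r]])
       (use \<epsilon> S r in \<open>auto simp: subset_iff\<close>)
  then show ?thesis by (simp add: o_def)
qed

lemma f_continuous_const:
  assumes "\<epsilon> > 0" "a \<ge> 0"
  shows "continuous_on {a..b} (\<lambda>s. f (s / \<epsilon>) t x)"
  by (rule f_continuous_along[where r = "norm x"]) (use assms in auto)

lemma f_integrable:
  assumes "a \<ge> 0" "\<epsilon> > 0"
  shows "(\<lambda>s. f (s / \<epsilon>) t x) integrable_on {a..b}"
  by (intro integrable_continuous_real f_continuous_const) (use assms in auto)

text \<open>A bound uniform in the fast time survives taking means and passing to the limit. Since
  time and state may both differ, continuity in time and the Lipschitz bound for \<open>F\<close>
  follow from the same fact.\<close>

lemma mean_diff_le: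
  assumes "\<And>\<tau>. \<tau> \<ge> 0 \<Longrightarrow> norm (f \<tau> t x - f \<tau> u y) \<le> B"
  shows "norm (F (t, x) - F (u, y)) \<le> B"
proof (rule field_le_epsilon)
  fix e :: real assume e: "e > 0"
  define r where "r = max (norm x) (norm y)"
  obtain T where T: "T > 0" and TT: "\<And>t x. norm x \<le> r \<Longrightarrow>
      norm ((1 / T) *\<^sub>R integral {0..T} (\<lambda>s. f s t x) - F (t, x)) \<le> e / 2"
    using mean[of "e/2" r] e by (metis add.right_neutral half_gt_zero order_refl)
  have i: "(\<lambda>s. f s t x) integrable_on {0..T}" for t x using f_integrable[of 0 1] by simp
  define D where "D = integral {0..T} (\<lambda>s. f s t x) - integral {0..T} (\<lambda>s. f s u y)"
  have "norm (integral {0..T} (\<lambda>s. f s t x - f s u y)) \<le> B * (T - 0)"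
  proof (rule integral_bound)
    have "continuous_on {0..T} (\<lambda>s. f (s / 1) t x - f (s / 1) u y)"
      by (intro continuous_intros f_continuous_const) auto
    then show "continuous_on {0..T} (\<lambda>s. f s t x - f s u y)" by simp
  qed (use T assms in auto)
  then have "norm D \<le> B * T" using i by (simp add: integral_diff D_def)
  then have D: "norm ((1 / T) *\<^sub>R D) \<le> B" using T by (simp add: field_simps)
  have "F (t, x) - F (u, y) = (1 / T) *\<^sub>R D
      - ((1 / T) *\<^sub>R integral {0..T} (\<lambda>s. f s t x) - F (t, x))
      + ((1 / T) *\<^sub>R integral {0..T} (\<lambda>s. f s u y) - F (u, y))"
    by (simp add: D_def algebra_simps)
  also have "norm \<dots> \<le> B + e / 2 + e / 2"
    by (intro norm_triangle_le norm_triangle_le_diff add_mono D TT) (auto simp: r_def)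
  finally show "norm (F (t, x) - F (u, y)) \<le> B + e" by simp
qed

lemma mean_norm_le:
  assumes "\<And>\<tau>. \<tau> \<ge> 0 \<Longrightarrow> norm (f \<tau> t x) \<le> B"
  shows "norm (F (t, x)) \<le> B"
proof (rule field_le_epsilon)
  fix e :: real assume e: "e > 0"
  obtain T where T: "T > 0" and TT: "norm ((1 / T) *\<^sub>R integral {0..T} (\<lambda>s. f s t x) - F (t, x)) \<le> e"
    using mean[of e "norm x"] e by (metis add.right_neutral order_refl)
  define D where "D = integral {0..T} (\<lambda>s. f s t x)"
  have "norm D \<le> B * (T - 0)"
    unfolding D_def
  proof (rule integral_bound)
    have "continuous_on {0..T} (\<lambda>s. f (s / 1) t x)"
      by (intro continuous_intros f_continuous_const) auto
    then show "continuous_on {0..T} (\<lambda>s. f s t x)" by simp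
  qed (use T assms in auto)
  then have D: "norm ((1 / T) *\<^sub>R D) \<le> B" using T by (simp add: field_simps)
  have "F (t, x) = (1 / T) *\<^sub>R D - ((1 / T) *\<^sub>R integral {0..T} (\<lambda>s. f s t x) - F (t, x))"
    by (simp add: D_def)
  also have "norm \<dots> \<le> B + e"
    by (intro norm_triangle_le_diff add_mono D TT)
  finally show "norm (F (t, x)) \<le> B + e" .
qed

text \<open>Continuity of the mean field has to be derived, because the hull lives in the space of
  continuous fields: without it the translates of \<open>F\<close> could not be placed in their own
  closure.\<close>

lemma F_cont: "continuous_on UNIV F"
proof (rule continuous_at_imp_continuous_on, intro ballI)
  fix p :: "real \<times> 'a"
  obtain t0 x0 where p: "p = (t0, x0)" by (cases p)
  define r where "r = norm x0 + 1"
  obtain L where L: "L \<ge> 0" "\<And>\<tau> t x y. \<tau> \<ge> 0 \<Longrightarrow> norm x \<le> r \<Longrightarrow> norm y \<le> r \<Longrightarrow>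
      norm (f \<tau> t x - f \<tau> t y) \<le> L * norm (x - y)"
    using f_lip[of r] by blast
  show "isCont F p"
    unfolding continuous_at_eps_delta
  proof (intro allI impI)
    fix e :: real assume e: "e > 0"
    obtain h where h: "h > 0" "\<And>\<tau> t1 t2 x. \<tau> \<ge> 0 \<Longrightarrow> \<bar>t1 - t2\<bar> < h \<Longrightarrow> norm x \<le> r \<Longrightarrow>
        norm (f \<tau> t1 x - f \<tau> t2 x) \<le> e / 4"
      using f_equi[of "e/4" r] e by (metis divide_pos_pos zero_less_numeral)
    \<comment> \<open>The time step and the state step each cost at most \<open>e / 4\<close>;
      \<open>L + 1\<close> avoids division by zero, and \<open>1\<close> keeps both points in the
      ball of radius \<open>r\<close>.\<close>
    define k where "k = min (min h 1) (e / (4 * (L + 1)))"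
    have k: "k > 0" "k \<le> h" "k \<le> 1" "L * k \<le> e / 4"
    proof -
      show "k > 0" using h(1) e L(1) by (simp add: k_def)
      show "k \<le> h" "k \<le> 1" unfolding k_def by linarith+
      have "L * k \<le> (L + 1) * (e / (4 * (L + 1)))"
        using e L(1) h(1) by (intro mult_mono) (auto simp: k_def)
      also have "\<dots> = e / 4" using L by (simp add: field_simps)
      finally show "L * k \<le> e / 4" .
    qed
    show "\<exists>d>0. \<forall>q. dist q p < d \<longrightarrow> dist (F q) (F p) < e"
    proof (intro exI conjI allI impI)
      show "k > 0" by (rule k)
      fix q assume q: "dist q p < k"
      obtain t x where qq: "q = (t, x)" by (cases q)
      have tx: "\<bar>t - t0\<bar> < k" "norm (x - x0) < k"
        using dist_fst_le[of q p] dist_snd_le[of q p] q by (auto simp: qq p dist_norm)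
      have nx: "norm x \<le> r" "norm x0 \<le> r"
        using tx(2) k(3) norm_triangle_sub[of x x0] by (auto simp: r_def)
      have "norm (F (t, x) - F (t0, x)) \<le> e / 4"
        by (rule mean_diff_le) (use h(2) tx k nx in auto)
      moreover have "norm (F (t0, x) - F (t0, x0)) \<le> L * norm (x - x0)"
        by (rule mean_diff_le) (use L(2) nx in auto)
      moreover have "L * norm (x - x0) \<le> e / 4"
        using k(4) tx L(1) by (meson less_imp_le mult_left_mono order_trans)
      ultimately show "dist (F q) (F p) < e"
        unfolding qq p dist_norm using norm_triangle_ineq[of "F (t, x) - F (t0, x)" "F (t0, x) - F (t0, x0)"] e by simp
    qed
  qed
qed

text \<open>The term \<open>C * \<epsilon>\<close> covers pieces too short, on the fast scale, for the mean value to be attained.\<close>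

lemma frozen_average:
  assumes \<gamma>: "\<gamma> > 0"
  obtains C where "C \<ge> 0" "\<And>\<epsilon> a h t x. \<epsilon> > 0 \<Longrightarrow> a \<ge> 0 \<Longrightarrow> h \<ge> 0 \<Longrightarrow> norm x \<le> r \<Longrightarrow>
      norm (integral {a..a + h} (\<lambda>s. f (s / \<epsilon>) t x - F (t, x))) \<le> \<gamma> * h + C * \<epsilon>"
proof -
  obtain M where M: "M \<ge> 0" "\<And>\<tau> t x. \<tau> \<ge> 0 \<Longrightarrow> norm x \<le> r \<Longrightarrow> norm (f \<tau> t x) \<le> M"
    using f_bound[of r] by blast
  have FM: "norm (F (t, x)) \<le> M" if "norm x \<le> r" for t x
    by (rule mean_norm_le) (use M that in auto)
  obtain T0 where T0: "T0 > 0" "\<And>T \<tau> t x. T \<ge> T0 \<Longrightarrow> \<tau> \<ge> 0 \<Longrightarrow> norm x \<le> r \<Longrightarrow>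
          norm ((1 / T) *\<^sub>R integral {\<tau>..T + \<tau>} (\<lambda>s. f s t x) - F (t, x)) \<le> \<gamma>"
    using mean[OF \<gamma>, of r] by blast
  show ?thesis
  proof (rule that[of "2 * M * T0"])
    show "2 * M * T0 \<ge> 0" using M T0 by simp
    fix \<epsilon> a h t :: real and x assume \<epsilon>: "\<epsilon> > 0" and a: "(a::real) \<ge> 0" and h: "h \<ge> 0" and x: "norm (x::'a) \<le> r"
    have i: "(\<lambda>s. f (s / \<epsilon>) t x) integrable_on {a..a+h}" by (rule f_integrable[OF a \<epsilon>])
    show "norm (integral {a..a + h} (\<lambda>s. f (s / \<epsilon>) t x - F (t, x))) \<le> \<gamma> * h + 2 * M * T0 * \<epsilon>"
    proof (cases "h / \<epsilon> \<ge> T0")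
      case True
      have hp: "h > 0" using True T0 \<epsilon> by (metis divide_eq_0_iff h leD order_le_less)
      define I where "I = integral {a/\<epsilon>..h/\<epsilon> + a/\<epsilon>} (\<lambda>s. f s t x)"
      have "((\<lambda>s. f s t x) has_integral I) (cbox (a/\<epsilon>) (h/\<epsilon> + a/\<epsilon>))"
        unfolding I_def using f_integrable[of "a/\<epsilon>" 1] a \<epsilon> by (auto intro!: integrable_integral)
      \<comment> \<open>On the fast scale the piece becomes a window of length
        \<open>h / \<epsilon>\<close> starting at \<open>a / \<epsilon>\<close>, which may lie
        arbitrarily far out. Uniformity of the mean in the starting point is what makes the estimate
        independent of \<open>a\<close>.\<close>
      from has_integral_affinity'[OF this, of "1/\<epsilon>" 0]
      have "((\<lambda>s. f (s / \<epsilon>) t x) has_integral (\<epsilon> *\<^sub>R I)) {a..a+h}"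
        using \<epsilon> by (simp add: algebra_simps)
      then have "integral {a..a + h} (\<lambda>s. f (s / \<epsilon>) t x) = \<epsilon> *\<^sub>R I" by (rule integral_unique)
      then have "integral {a..a + h} (\<lambda>s. f (s / \<epsilon>) t x - F (t, x)) = \<epsilon> *\<^sub>R I - h *\<^sub>R F (t, x)"
        using i h by (subst integral_diff) auto
      also have "\<dots> = h *\<^sub>R ((1 / (h / \<epsilon>)) *\<^sub>R I - F (t, x))"
        using hp \<epsilon> by (simp add: algebra_simps)
      also have "norm \<dots> \<le> h * \<gamma>"
        unfolding norm_scaleR I_def using T0(2)[OF True _ x, of "a/\<epsilon>" t] a h \<epsilon>
        by (simp add: mult_left_mono)
      also have "\<dots> \<le> \<gamma> * h + 2 * M * T0 * \<epsilon>" using M T0 \<epsilon> by simp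
      finally show ?thesis .
    next
      case False
      have "norm (integral {a..a + h} (\<lambda>s. f (s / \<epsilon>) t x - F (t, x))) \<le> 2 * M * (a + h - a)"
      proof (rule integral_bound)
        show "continuous_on {a..a + h} (\<lambda>s. f (s / \<epsilon>) t x - F (t, x))"
          by (intro continuous_intros f_continuous_const) (use a \<epsilon> in auto)
        show "norm (f (s / \<epsilon>) t x - F (t, x)) \<le> 2 * M" if "s \<in> {a..a + h}" for s
          using norm_triangle_ineq4[of "f (s / \<epsilon>) t x" "F (t, x)"] M(2)[OF _ x, of "s/\<epsilon>" t] FM[OF x, of t] a \<epsilon> that
          by simp
      qed (use h in auto)
      also have "\<dots> \<le> 2 * M * (T0 * \<epsilon>)"
        using False \<epsilon> M by (intro mult_left_mono) (auto simp: field_simps)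
      also have "\<dots> \<le> \<gamma> * h + 2 * M * T0 * \<epsilon>" using \<gamma> h by simp
      finally show ?thesis .
    qed
  qed
qed

text \<open>On short pieces the slow time and the averaged solution are frozen at the left endpoint,
  which reduces the integral to a mean value of \<open>f\<close> at a fixed point. The number of
  pieces depends neither on \<open>\<epsilon>\<close> nor on the window or the solution, so one
  threshold \<open>\<epsilon>0\<close> works for all of them.\<close>

lemma averaging_defect:
  assumes T: "T \<ge> 0" and \<kappa>: "\<kappa> > 0"
  obtains \<epsilon>0 where "\<epsilon>0 > 0" "\<And>\<epsilon> s0 v t. 0 < \<epsilon> \<Longrightarrow> \<epsilon> < \<epsilon>0 \<Longrightarrow> s0 \<ge> 0 \<Longrightarrow>
      (\<And>s. s \<in> {s0..s0+T} \<Longrightarrow> (v has_vector_derivative F (s, v s)) (at s within {s0..s0+T})) \<Longrightarrow>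
      (\<And>s. s \<in> {s0..s0+T} \<Longrightarrow> norm (v s) \<le> r) \<Longrightarrow> t \<in> {s0..s0+T} \<Longrightarrow>
      norm (integral {s0..t} (\<lambda>s. f (s / \<epsilon>) s (v s) - F (s, v s))) \<le> \<kappa>"
proof -
  obtain M where M: "M \<ge> 0" "\<And>\<tau> t x. \<tau> \<ge> 0 \<Longrightarrow> norm x \<le> r \<Longrightarrow> norm (f \<tau> t x) \<le> M"
    using f_bound[of r] by blast
  have FM: "norm (F (t, x)) \<le> M" if "norm x \<le> r" for t x
    by (rule mean_norm_le) (use M that in auto)
  obtain L where L: "L \<ge> 0" "\<And>\<tau> t x y. \<tau> \<ge> 0 \<Longrightarrow> norm x \<le> r \<Longrightarrow> norm y \<le> r \<Longrightarrow>
      norm (f \<tau> t x - f \<tau> t y) \<le> L * norm (x - y)"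
    using f_lip[of r] by blast
  define \<eta> where "\<eta> = \<kappa> / (10 * (T + 1))"
  have \<eta>: "\<eta> > 0" using \<kappa> T by (simp add: \<eta>_def)
  obtain h where h: "h > 0" "\<And>\<tau> t1 t2 x. \<tau> \<ge> 0 \<Longrightarrow> \<bar>t1 - t2\<bar> < h \<Longrightarrow> norm x \<le> r \<Longrightarrow>
      norm (f \<tau> t1 x - f \<tau> t2 x) \<le> \<eta>"
    using f_equi[OF \<eta>, of r] by blast
  obtain C where C: "C \<ge> 0" "\<And>\<epsilon> a h t x. \<epsilon> > 0 \<Longrightarrow> a \<ge> 0 \<Longrightarrow> h \<ge> 0 \<Longrightarrow> norm x \<le> r \<Longrightarrow>
      norm (integral {a..a + h} (\<lambda>s. f (s / \<epsilon>) t x - F (t, x))) \<le> \<eta> * h + C * \<epsilon>"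
    using frozen_average[OF \<eta>, of r] by blast
  \<comment> \<open>The pieces are short enough both for equicontinuity in time and for the motion
    of \<open>v\<close>, whose speed is at most \<open>M\<close>.\<close>
  obtain N :: nat where N: "N > 0" "T / N < h" "L * M * (T / N) \<le> \<eta>"
  proof -
    obtain N :: nat where "max (T / h) (L * M * T / \<eta>) < N" using reals_Archimedean2 by blast
    then have *: "T / h < N" "L * M * T / \<eta> < N" by auto
    then have "N > 0" using T h by (metis divide_nonneg_pos less_le_trans not_gr_zero of_nat_0 order_less_irrefl)
    then show ?thesis using * h \<eta> that[of N] by (simp add: field_simps)
  qed
  \<comment> \<open>Each of the \<open>N\<close> pieces contributes an extra
    \<open>C * \<epsilon>\<close>; together these use the other half of
    \<open>\<kappa>\<close>.\<close>
  define \<epsilon>0 where "\<epsilon>0 = \<kappa> / (2 * N * (C + 1))"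
  show ?thesis
  proof (rule that[of \<epsilon>0])
    show "\<epsilon>0 > 0" using \<kappa> N C by (simp add: \<epsilon>0_def)
    fix \<epsilon> s0 t :: real and v
    assume \<epsilon>: "0 < \<epsilon>" "\<epsilon> < \<epsilon>0" and s0: "s0 \<ge> 0"
      and v: "\<And>s. s \<in> {s0..s0+T} \<Longrightarrow> (v has_vector_derivative F (s, v s)) (at s within {s0..s0+T})"
      and vr: "\<And>s. s \<in> {s0..s0+T} \<Longrightarrow> norm (v s) \<le> r" and t: "t \<in> {s0..s0+T}"
    define g where "g s = f (s / \<epsilon>) s (v s) - F (s, v s)" for s
    have cv: "continuous_on {s0..s0+T} v"
      using v by (meson continuous_on_eq_continuous_within has_vector_derivative_continuous)
    have cg: "continuous_on {s0..s0+T} g"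
      unfolding g_def
      by (intro continuous_intros f_continuous_along[where r = r] continuous_on_compose2[OF F_cont] cv)
         (use \<epsilon> s0 vr in auto)
    have v_lip: "norm (v b - v a) \<le> M * (b - a)" if "s0 \<le> a" "a \<le> b" "b \<le> s0 + T" for a b
    proof -
      have sub: "{a..b} \<subseteq> {s0..s0+T}" using that by auto
      have "((\<lambda>s. F (s, v s)) has_integral (v b - v a)) {a..b}"
        by (rule fundamental_theorem_of_calculus[OF that(2)])
           (use sub in \<open>auto intro!: has_vector_derivative_within_subset[OF v]\<close>)
      then have "norm (v b - v a) \<le> M * measure lborel {a..b}"
        by (rule has_integral_bound_real[OF M(1) finite.emptyI]) (use sub FM vr in auto)
      then show ?thesis using that by simp
    qed
    have piece: "norm (integral {a..b} g) \<le> 5 * \<eta> * (b - a) + C * \<epsilon>"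
      if ab: "s0 \<le> a" "a \<le> b" "b \<le> s0 + T" "b - a \<le> T / N" for a b
    proof -
      define k where "k s = f (s / \<epsilon>) a (v a) - F (a, v a)" for s
      have sub: "{a..b} \<subseteq> {s0..s0+T}" using that by auto
      have va: "norm (v a) \<le> r" using vr ab by simp
      have "continuous_on {a..b} g" by (rule continuous_on_subset[OF cg sub])
      moreover have "continuous_on {a..b} k"
        unfolding k_def by (intro continuous_intros f_continuous_const) (use \<epsilon> ab s0 in auto)
      ultimately have c: "continuous_on {a..b} (\<lambda>s. g s - k s)" "g integrable_on {a..b}" "k integrable_on {a..b}"
        by (auto intro!: continuous_intros integrable_continuous_real)
      have "norm (integral {a..b} (\<lambda>s. g s - k s)) \<le> 4 * \<eta> * (b - a)"
      proof (rule integral_bound[OF ab(2) c(1)])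
        fix s assume s: "s \<in> {a..b}"
        have vs: "norm (v s) \<le> r" using vr s ab by simp
        have close: "\<bar>s - a\<bar> < h" using s ab N by simp
        have "norm (v s - v a) \<le> M * (s - a)" by (rule v_lip) (use s ab in auto)
        also have "\<dots> \<le> M * (T / N)" using s ab M by (intro mult_left_mono) auto
        finally have "L * norm (v s - v a) \<le> L * (M * (T / N))" using L by (intro mult_left_mono)
        then have Lv: "L * norm (v s - v a) \<le> \<eta>" using N by (simp add: mult.assoc)
        have f2: "norm (f \<tau> s (v s) - f \<tau> a (v a)) \<le> 2 * \<eta>" if "\<tau> \<ge> 0" for \<tau>
        proof -
          have "norm ((f \<tau> s (v s) - f \<tau> a (v s)) + (f \<tau> a (v s) - f \<tau> a (v a))) \<le> \<eta> + L * norm (v s - v a)"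
            by (intro norm_triangle_le add_mono h(2) L(2) that close vs va)
          then show ?thesis using Lv by simp
        qed
        \<comment> \<open>The preceding bound holds for every fast time and so passes to the mean,
          doubling the cost of freezing to \<open>4 * \<eta>\<close>.\<close>
        have F2: "norm (F (s, v s) - F (a, v a)) \<le> 2 * \<eta>" by (rule mean_diff_le[OF f2])
        have "g s - k s = (f (s / \<epsilon>) s (v s) - f (s / \<epsilon>) a (v a)) - (F (s, v s) - F (a, v a))"
          by (simp add: g_def k_def)
        also have "norm \<dots> \<le> 2 * \<eta> + 2 * \<eta>"
          by (intro norm_triangle_le_diff add_mono f2 F2) (use s ab s0 \<epsilon> in auto)
        finally show "norm (g s - k s) \<le> 4 * \<eta>" by simp
      qed
      moreover have "norm (integral {a..b} k) \<le> \<eta> * (b - a) + C * \<epsilon>"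
        unfolding k_def using C(2)[OF \<epsilon>(1) _ _ va, of a "b - a" a] ab s0 by simp
      moreover have "integral {a..b} g = integral {a..b} (\<lambda>s. g s - k s) + integral {a..b} k"
        using c by (simp add: integral_diff)
      ultimately show ?thesis
        using norm_triangle_ineq[of "integral {a..b} (\<lambda>s. g s - k s)" "integral {a..b} k"] by (simp add: algebra_simps)
    qed
    \<comment> \<open>Subdividing up to \<open>t\<close> itself, rather than the full window, avoids
      an incomplete last piece; the pieces are still no longer than \<open>T / N\<close>.\<close>
    define \<delta> where "\<delta> = (t - s0) / N"
    have \<delta>: "\<delta> \<ge> 0" "\<delta> \<le> T / N" "N * \<delta> = t - s0"
      using t N by (auto simp: \<delta>_def divide_right_mono)
    have sum: "norm (integral {s0..s0 + k * \<delta>} g) \<le> 5 * \<eta> * (k * \<delta>) + k * (C * \<epsilon>)" if "k \<le> N" for k :: nat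
      using that
    proof (induction k)
      case (Suc k)
      have "Suc k * \<delta> \<le> N * \<delta>" using Suc.prems \<delta> by (intro mult_right_mono) auto
      then have le: "s0 + Suc k * \<delta> \<le> s0 + T" using \<delta> t by simp
      have le2: "s0 \<le> s0 + k * \<delta>" "s0 + k * \<delta> \<le> s0 + Suc k * \<delta>" using \<delta> by (auto simp: algebra_simps)
      have "g integrable_on {s0..s0 + Suc k * \<delta>}"
        by (intro integrable_continuous_real continuous_on_subset[OF cg]) (use le in auto)
      then have "integral {s0..s0 + Suc k * \<delta>} g = integral {s0..s0 + k * \<delta>} g + integral {s0 + k * \<delta>..s0 + Suc k * \<delta>} g"
        by (rule Henstock_Kurzweil_Integration.integral_combine[OF le2, symmetric])
      also have "norm \<dots> \<le> (5 * \<eta> * (k * \<delta>) + k * (C * \<epsilon>)) + (5 * \<eta> * ((s0 + Suc k * \<delta>) - (s0 + k * \<delta>)) + C * \<epsilon>)"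
        by (intro norm_triangle_le add_mono Suc.IH piece le le2) (use Suc.prems \<delta> in \<open>auto simp: algebra_simps\<close>)
      also have "\<dots> = 5 * \<eta> * (Suc k * \<delta>) + Suc k * (C * \<epsilon>)" by (simp add: algebra_simps)
      finally show ?case .
    qed simp
    have "norm (integral {s0..t} g) \<le> 5 * \<eta> * (t - s0) + N * (C * \<epsilon>)"
      using sum[OF order_refl] \<delta>(3) by simp
    also have "\<dots> \<le> \<kappa> / 2 + \<kappa> / 2"
    proof (rule add_mono)
      have "5 * \<eta> * (t - s0) \<le> 5 * \<eta> * (T + 1)" using t \<eta> by (intro mult_left_mono) auto
      also have "\<dots> = \<kappa> / 2" using T by (simp add: \<eta>_def field_simps)
      finally show "5 * \<eta> * (t - s0) \<le> \<kappa> / 2" .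
      have "N * (C * \<epsilon>) \<le> N * ((C + 1) * \<epsilon>0)"
        using \<epsilon> C by (intro mult_left_mono mult_mono) auto
      also have "\<dots> = \<kappa> / 2"
      proof -
        have "real N \<noteq> 0" "C + 1 \<noteq> 0" using N C(1) by auto
        then show ?thesis by (simp add: \<epsilon>0_def)
      qed
      finally show "N * (C * \<epsilon>) \<le> \<kappa> / 2" .
    qed
    finally show "norm (integral {s0..t} (\<lambda>s. f (s / \<epsilon>) s (v s) - F (s, v s))) \<le> \<kappa>"
      by (simp add: g_def[abs_def])
  qed
qed

text \<open>Only the averaged solution has to stay in the ball. The other one solves the truncated
  equation, so no a priori bound on it is required.\<close>

lemma averaging_estimate:
  assumes r: "r \<ge> 0" and T: "T \<ge> 0" and \<kappa>: "\<kappa> > 0"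
  obtains \<epsilon>0 where "\<epsilon>0 > 0" "\<And>\<epsilon> s0 y v t. 0 < \<epsilon> \<Longrightarrow> \<epsilon> < \<epsilon>0 \<Longrightarrow> s0 \<ge> 0 \<Longrightarrow>
      (\<And>s. s \<in> {s0..s0+T} \<Longrightarrow> (y has_vector_derivative f (s / \<epsilon>) s (closest_point (cball 0 r) (y s)))
          (at s within {s0..s0+T})) \<Longrightarrow>
      (\<And>s. s \<in> {s0..s0+T} \<Longrightarrow> (v has_vector_derivative F (s, v s)) (at s within {s0..s0+T})) \<Longrightarrow>
      (\<And>s. s \<in> {s0..s0+T} \<Longrightarrow> norm (v s) \<le> r) \<Longrightarrow> y s0 = v s0 \<Longrightarrow> t \<in> {s0..s0+T} \<Longrightarrow>
      norm (y t - v t) \<le> \<kappa>"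
proof -
  note cp = closest_point_cball[OF r]
  obtain L where L: "L \<ge> 0" "\<And>\<tau> t x y. \<tau> \<ge> 0 \<Longrightarrow> norm x \<le> r \<Longrightarrow> norm y \<le> r \<Longrightarrow>
      norm (f \<tau> t x - f \<tau> t y) \<le> L * norm (x - y)"
    using f_lip[of r] by blast
  \<comment> \<open>The permitted defect anticipates the Gronwall factor over the whole
    window.\<close>
  define \<rho> where "\<rho> = \<kappa> * exp (- (L * T))"
  have \<rho>: "\<rho> > 0" using \<kappa> by (simp add: \<rho>_def)
  obtain \<epsilon>0 where \<epsilon>0: "\<epsilon>0 > 0" "\<And>\<epsilon> s0 v t. 0 < \<epsilon> \<Longrightarrow> \<epsilon> < \<epsilon>0 \<Longrightarrow> s0 \<ge> 0 \<Longrightarrow>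
      (\<And>s. s \<in> {s0..s0+T} \<Longrightarrow> (v has_vector_derivative F (s, v s)) (at s within {s0..s0+T})) \<Longrightarrow>
      (\<And>s. s \<in> {s0..s0+T} \<Longrightarrow> norm (v s) \<le> r) \<Longrightarrow> t \<in> {s0..s0+T} \<Longrightarrow>
      norm (integral {s0..t} (\<lambda>s. f (s / \<epsilon>) s (v s) - F (s, v s))) \<le> \<rho>"
    using averaging_defect[OF T \<rho>, of r] by blast
  show ?thesis
  proof (rule that[OF \<epsilon>0(1)])
    fix \<epsilon> s0 t :: real and y v
    assume \<epsilon>: "0 < \<epsilon>" "\<epsilon> < \<epsilon>0" and s0: "s0 \<ge> 0"
      and y: "\<And>s. s \<in> {s0..s0+T} \<Longrightarrow> (y has_vector_derivative f (s / \<epsilon>) s (closest_point (cball 0 r) (y s)))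
          (at s within {s0..s0+T})"
      and v: "\<And>s. s \<in> {s0..s0+T} \<Longrightarrow> (v has_vector_derivative F (s, v s)) (at s within {s0..s0+T})"
      and vr: "\<And>s. s \<in> {s0..s0+T} \<Longrightarrow> norm (v s) \<le> r" and eq: "y s0 = v s0" and t: "t \<in> {s0..s0+T}"
    define G where "G s x = f (s / \<epsilon>) s (closest_point (cball 0 r) x)" for s x
    have Gv: "G s (v s) = f (s / \<epsilon>) s (v s)" if "s \<in> {s0..s0+T}" for s
      unfolding G_def using cp(3)[OF vr[OF that]] by simp
    have cv: "continuous_on {s0..s0+T} v"
      using v by (meson continuous_on_eq_continuous_within has_vector_derivative_continuous)
    have "continuous_on {s0..s0+T} (\<lambda>s. f (s / \<epsilon>) s (v s))"
      by (intro f_continuous_along[where r = r] continuous_intros cv) (use \<epsilon> s0 vr in auto)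
    then have "continuous_on {s0..s0+T} (\<lambda>s. G s (v s))"
      using continuous_on_cong[OF refl Gv, of "{s0..s0+T}"] by simp
    then have int: "(\<lambda>s. G s (v s)) integrable_on {s0..s0+T}" by (rule integrable_continuous_real)
    have "norm (y t - v t) \<le> (norm (y s0 - v s0) + \<rho>) * exp (L * (t - s0))"
    proof (rule ode_perturbation[where G = G and h = "\<lambda>s. F (s, v s)", OF L(1) _ v _ int _ t])
      show "(y has_vector_derivative G s (y s)) (at s within {s0..s0+T})" if "s \<in> {s0..s0+T}" for s
        unfolding G_def by (rule y[OF that])
      show "norm (G s (y s) - G s (v s)) \<le> L * norm (y s - v s)" if "s \<in> {s0..s0+T}" for s
      proof -
        have "norm (G s (y s) - G s (v s)) \<le> L * norm (closest_point (cball 0 r) (y s) - closest_point (cball 0 r) (v s))"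
          unfolding G_def by (rule L(2)) (use that s0 \<epsilon> cp in auto)
        also have "\<dots> \<le> L * norm (y s - v s)" by (intro mult_left_mono cp L)
        finally show ?thesis .
      qed
      show "norm (integral {s0..t} (\<lambda>s. G s (v s) - F (s, v s))) \<le> \<rho>" if t: "t \<in> {s0..s0+T}" for t
      proof -
        have "integral {s0..t} (\<lambda>s. G s (v s) - F (s, v s)) = integral {s0..t} (\<lambda>s. f (s / \<epsilon>) s (v s) - F (s, v s))"
          using t by (intro integral_cong) (simp add: Gv)
        then show ?thesis using \<epsilon>0(2)[OF \<epsilon> s0 v vr t] by simp
      qed
    qed
    also have "\<dots> = \<rho> * exp (L * (t - s0))" using eq by simp
    also have "\<dots> \<le> \<rho> * exp (L * T)" using t L \<rho> by (auto intro!: mult_left_mono)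
    also have "\<dots> = \<kappa>" by (simp add: \<rho>_def exp_minus)
    finally show "norm (y t - v t) \<le> \<kappa>" .
  qed
qed

end

section \<open>Hull topology and Hausdorff distance\<close>

lemma topspace_compact_open_topology:
  "topspace compact_open_topology = {h. continuous_on UNIV h}"
proof -
  have "\<Union>{{h. continuous_on UNIV h \<and> h ` K \<subseteq> U} |K U. compact K \<and> open U} = {h. continuous_on UNIV h}"
    (is "\<Union>?B = ?C")
  proof
    have "?C = {h. continuous_on UNIV h \<and> h ` {} \<subseteq> UNIV}" by simp
    moreover have "compact {}" "open UNIV" by simp_all
    ultimately have "?C \<in> ?B" by blast
    then show "?C \<subseteq> \<Union>?B" by (rule Union_upper)
  qed blast
  then show ?thesis unfolding compact_open_topology_def by simp
qed

lemma openin_compact_open_topology: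
  assumes "compact K" "open U"
  shows "openin compact_open_topology {h. continuous_on UNIV h \<and> h ` K \<subseteq> U}"
  unfolding compact_open_topology_def
  by (rule topology_generated_by_Basis) (use assms in blast)

text \<open>Compact-open neighbourhoods control uniform distance on compacta: \<open>K\<close> is
  covered by finitely many compact pieces on which \<open>\<omega>\<close> varies by less than
  \<open>\<eta> / 2\<close>, and each piece contributes one subbasic set.\<close>

lemma compact_open_topology_uniform_nbhd:
  fixes \<omega> :: "'a::metric_space \<Rightarrow> 'b::metric_space"
  assumes \<omega>: "continuous_on UNIV \<omega>" and K: "compact K" and \<eta>: "\<eta> > 0"
  obtains W where "openin compact_open_topology W" "\<omega> \<in> W" "\<And>h p. h \<in> W \<Longrightarrow> p \<in> K \<Longrightarrow> dist (h p) (\<omega> p) < \<eta>"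
proof -
  have "uniformly_continuous_on K \<omega>"
    by (rule compact_uniformly_continuous[OF continuous_on_subset[OF \<omega>] K]) auto
  then obtain e where e: "e > 0" "\<And>p q. p \<in> K \<Longrightarrow> q \<in> K \<Longrightarrow> dist p q < e \<Longrightarrow> dist (\<omega> p) (\<omega> q) < \<eta> / 2"
    unfolding uniformly_continuous_on_def using \<eta> by (metis half_gt_zero)
  obtain P where P: "finite P" "P \<subseteq> K" "K \<subseteq> (\<Union>p\<in>P. ball p (e / 2))"
    using compactE_image[OF K, of K "\<lambda>p. ball p (e / 2)"] e by (metis UN_I centre_in_ball half_gt_zero open_ball subsetI)
  define V where "V p = {h. continuous_on UNIV h \<and> h ` (K \<inter> cball p (e / 2)) \<subseteq> ball (\<omega> p) (\<eta> / 2)}" for p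
  \<comment> \<open>For empty \<open>K\<close> the family \<open>P\<close> may be empty and its
    intersection \<open>UNIV\<close>; intersecting with the carrier keeps \<open>W\<close> open in
    that case.\<close>
  define W where "W = topspace compact_open_topology \<inter> \<Inter>(V ` P)"
  have "openin compact_open_topology (V p)" for p
    unfolding V_def by (rule openin_compact_open_topology) (use K in auto)
  then have "openin compact_open_topology W"
    unfolding W_def by (subst Int_commute) (intro openin_INT P(1))
  moreover have "\<omega> \<in> W"
    unfolding W_def V_def topspace_compact_open_topology using \<omega> e P(2) by (auto simp: subset_iff)
  moreover have "dist (h q) (\<omega> q) < \<eta>" if h: "h \<in> W" and q: "q \<in> K" for h q
  proof -
    obtain p where p: "p \<in> P" "dist p q < e / 2" using P(3) q by auto
    have "h ` (K \<inter> cball p (e / 2)) \<subseteq> ball (\<omega> p) (\<eta> / 2)" using h p(1) unfolding W_def V_def by blast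
    moreover have "q \<in> K \<inter> cball p (e / 2)" using p(2) q by simp
    ultimately have "h q \<in> ball (\<omega> p) (\<eta> / 2)" by blast
    moreover have "dist (\<omega> p) (\<omega> q) < \<eta> / 2" using e p q P(2) by auto
    ultimately show ?thesis
      using dist_triangle[of "h q" "\<omega> q" "\<omega> p"] by (simp add: dist_commute)
  qed
  ultimately show ?thesis by (rule that)
qed

lemma field_hull_continuous: "\<omega> \<in> field_hull F \<Longrightarrow> continuous_on UNIV \<omega>"
  unfolding field_hull_def in_closure_of topspace_compact_open_topology by simp

lemma topspace_hull_topology: "topspace (hull_topology (field_hull F)) = field_hull F"
  unfolding hull_topology_def topspace_subtopology topspace_compact_open_topology
  using field_hull_continuous by blast

lemma shift_in_field_hull:
  assumes "continuous_on UNIV F"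
  shows "shift F s \<in> field_hull F"
proof -
  have "range (shift F) \<subseteq> topspace compact_open_topology"
    unfolding topspace_compact_open_topology shift_def case_prod_unfold
    by (auto intro!: continuous_intros continuous_on_compose2[OF assms])
  then show ?thesis unfolding field_hull_def using closure_of_subset by blast
qed

text \<open>This is how bounds reach the hull: an estimate invariant under time translation holds
  for the approximating translate of \<open>F\<close> and survives the limit.\<close>

lemma field_hull_approx:
  assumes \<omega>: "\<omega> \<in> field_hull F" and K: "compact K" and \<eta>: "\<eta> > 0"
  obtains s where "\<And>t x. (t, x) \<in> K \<Longrightarrow> dist (F (t + s, x)) (\<omega> (t, x)) < \<eta>"
proof -
  obtain W where W: "openin compact_open_topology W" "\<omega> \<in> W" "\<And>h p. h \<in> W \<Longrightarrow> p \<in> K \<Longrightarrow> dist (h p) (\<omega> p) < \<eta>"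
    using compact_open_topology_uniform_nbhd[OF field_hull_continuous[OF \<omega>] K \<eta>] by blast
  obtain s where "shift F s \<in> W"
    using \<omega> W(1,2) unfolding field_hull_def in_closure_of by blast
  then show ?thesis using W(3) that[of s] by (force simp: shift_def)
qed

text \<open>A Lebesgue number argument. It replaces uniform continuity when closeness of values is
  described by neighbourhoods, as for fields in the compact-open topology and for the set-valued
  fiber map.\<close>

lemma (in Metric_space) compact_close_points_in_common_nbhd:
  assumes comp: "compactin mtopology M"
    and W: "\<And>x. x \<in> M \<Longrightarrow> openin mtopology (W x) \<and> x \<in> W x"
  obtains \<delta> where "\<delta> > 0" "\<And>x y. x \<in> M \<Longrightarrow> y \<in> M \<Longrightarrow> d x y < \<delta> \<Longrightarrow> \<exists>z\<in>M. x \<in> W z \<and> y \<in> W z"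
proof -
  have "\<exists>\<epsilon>>0. \<forall>x\<in>M. \<exists>U\<in>W ` M. mball x \<epsilon> \<subseteq> U"
    by (rule lebesgue_number[OF comp]) (use W in auto)
  then obtain \<delta> where \<delta>: "\<delta> > 0" "\<And>x. x \<in> M \<Longrightarrow> \<exists>z\<in>M. mball x \<delta> \<subseteq> W z" by auto
  show ?thesis
  proof (rule that[OF \<delta>(1)])
    fix x y assume xy: "x \<in> M" "y \<in> M" "d x y < \<delta>"
    then have "x \<in> mball x \<delta>" "y \<in> mball x \<delta>" using \<delta>(1) by (auto simp: mball_def)
    then show "\<exists>z\<in>M. x \<in> W z \<and> y \<in> W z" using \<delta>(2)[OF xy(1)] by blast
  qed
qed

text \<open>The metric \<open>d\<close> is arbitrary apart from the topology it induces, so no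
  formula links it to the values of fields; compactness of the hull supplies the uniform
  link.\<close>

lemma field_hull_uniformly_close:
  assumes metric: "Metric_space (field_hull F) d" "Metric_space.mtopology (field_hull F) d = hull_topology (field_hull F)"
    and comp: "compactin (hull_topology (field_hull F)) (field_hull F)"
    and K: "compact K" and \<eta>: "\<eta> > 0"
  obtains \<mu> where "\<mu> > 0" "\<And>\<omega> \<omega>' p. \<omega> \<in> field_hull F \<Longrightarrow> \<omega>' \<in> field_hull F \<Longrightarrow> d \<omega> \<omega>' < \<mu> \<Longrightarrow>
      p \<in> K \<Longrightarrow> dist (\<omega> p) (\<omega>' p) \<le> \<eta>"
proof -
  interpret Metric_space "field_hull F" d by (rule metric(1))
  have "\<exists>W. openin compact_open_topology W \<and> \<omega> \<in> W \<and> (\<forall>h\<in>W. \<forall>p\<in>K. dist (h p) (\<omega> p) < \<eta> / 2)"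
    if "\<omega> \<in> field_hull F" for \<omega>
    by (rule compact_open_topology_uniform_nbhd[OF field_hull_continuous[OF that] K half_gt_zero[OF \<eta>]]) blast
  then obtain W where W: "\<And>\<omega>. \<omega> \<in> field_hull F \<Longrightarrow> openin compact_open_topology (W \<omega>) \<and> \<omega> \<in> W \<omega>
      \<and> (\<forall>h\<in>W \<omega>. \<forall>p\<in>K. dist (h p) (\<omega> p) < \<eta> / 2)" by metis
  have 1: "openin mtopology (field_hull F \<inter> W \<omega>) \<and> \<omega> \<in> field_hull F \<inter> W \<omega>" if "\<omega> \<in> field_hull F" for \<omega>
    unfolding metric(2) hull_topology_def using W[OF that] that by (simp add: openin_subtopology_Int2)
  obtain \<mu> where \<mu>: "\<mu> > 0" "\<And>\<omega> \<omega>'. \<omega> \<in> field_hull F \<Longrightarrow> \<omega>' \<in> field_hull F \<Longrightarrow> d \<omega> \<omega>' < \<mu> \<Longrightarrow>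
      \<exists>z\<in>field_hull F. \<omega> \<in> field_hull F \<inter> W z \<and> \<omega>' \<in> field_hull F \<inter> W z"
    using compact_close_points_in_common_nbhd[OF comp[folded metric(2)], of "\<lambda>\<omega>. field_hull F \<inter> W \<omega>"] 1 by blast
  show ?thesis
  proof (rule that[OF \<mu>(1)])
    fix \<omega> \<omega>' p assume a: "\<omega> \<in> field_hull F" "\<omega>' \<in> field_hull F" "d \<omega> \<omega>' < \<mu>" "p \<in> K"
    then obtain z where "z \<in> field_hull F" "\<omega> \<in> W z" "\<omega>' \<in> W z" using \<mu>(2) by blast
    then have "dist (\<omega> p) (z p) < \<eta> / 2" "dist (\<omega>' p) (z p) < \<eta> / 2" using W a(4) by blast+
    then show "dist (\<omega> p) (\<omega>' p) \<le> \<eta>" using dist_triangle2[of "\<omega> p" "\<omega>' p" "z p"] by simp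
  qed
qed

section \<open>Distances to sets and the Hausdorff metric\<close>

lemma dist_to_less_obtain:
  assumes "dist_to d y C < ennreal e"
  obtains c where "c \<in> C" "d y c < e"
proof -
  obtain c where "c \<in> C" "ennreal (d y c) < ennreal e"
    using assms unfolding dist_to_def INF_less_iff by blast
  moreover then have "d y c < e" by (meson ennreal_leI linorder_not_less)
  ultimately show ?thesis using that by blast
qed

lemma dist_to_le:
  assumes "c \<in> C" "d y c \<le> e"
  shows "dist_to d y C \<le> ennreal e"
  unfolding dist_to_def using assms by (meson INF_lower2 ennreal_leI)

lemma dist_to_compact_le_iff:
  assumes C: "compact C" "C \<noteq> {}" and e: "e \<ge> 0"
  shows "dist_to dist y C \<le> ennreal e \<longleftrightarrow> (\<exists>c\<in>C. dist y c \<le> e)"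
proof
  assume le: "dist_to dist y C \<le> ennreal e"
  obtain c where c: "c \<in> C" "\<And>c'. c' \<in> C \<Longrightarrow> dist y c \<le> dist y c'"
    using continuous_attains_inf[OF C, of "dist y"] continuous_on_dist[OF continuous_on_const continuous_on_id, of C y]
    by blast
  have "ennreal (dist y c) \<le> dist_to dist y C"
    unfolding dist_to_def by (intro INF_greatest ennreal_leI c)
  then have "dist y c \<le> e" using le e by (metis ennreal_le_iff order_trans)
  then show "\<exists>c\<in>C. dist y c \<le> e" using c by blast
qed (auto intro: dist_to_le)

text \<open>Distances to compact sets are attained, which turns the extended-real suprema and infima
  into quantifiers over points with non-strict inequalities.\<close>

lemma hausdorff_dist_le_iff:
  assumes C: "compact C" "C \<noteq> {}" and D: "compact D" "D \<noteq> {}" and e: "e \<ge> 0"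
  shows "hausdorff_dist dist C D \<le> e \<longleftrightarrow> (\<forall>x\<in>C. \<exists>y\<in>D. dist x y \<le> e) \<and> (\<forall>y\<in>D. \<exists>x\<in>C. dist x y \<le> e)"
proof -
  have semi: "semidist dist X Y \<le> ennreal e \<longleftrightarrow> (\<forall>x\<in>X. \<exists>y\<in>Y. dist x y \<le> e)"
    if "compact Y" "Y \<noteq> {}" "e \<ge> 0" for X Y :: "'a set" and e
    unfolding semidist_def SUP_le_iff using dist_to_compact_le_iff[OF that] by simp
  \<comment> \<open>Finiteness must be established first: \<open>enn2real\<close> maps infinity to
    \<open>0\<close>, so an infinite semidistance would satisfy the left-hand side
    vacuously.\<close>
  have "bounded (C \<union> D)" using C D by (simp add: compact_imp_bounded)
  then obtain b where b: "\<And>x y. x \<in> C \<union> D \<Longrightarrow> y \<in> C \<union> D \<Longrightarrow> dist x y \<le> b"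
    unfolding bounded_two_points by blast
  have b0: "b \<ge> 0" using b C(2) zero_le_dist order_trans by blast
  have "semidist dist C D \<le> ennreal b" "semidist dist D C \<le> ennreal b"
    using semi[OF D b0] semi[OF C b0] b C(2) D(2) by (meson UnI1 UnI2 ex_in_conv)+
  then have "max (semidist dist C D) (semidist dist D C) < top"
    by (simp add: le_less_trans[OF _ ennreal_less_top])
  then have "hausdorff_dist dist C D \<le> e \<longleftrightarrow> max (semidist dist C D) (semidist dist D C) \<le> ennreal e"
    unfolding hausdorff_dist_def using e by (metis enn2real_leI ennreal_enn2real ennreal_leI)
  then show ?thesis using semi[OF D e] semi[OF C e] by (simp add: dist_commute)
qed

lemma hausdorff_dist_nonneg: "hausdorff_dist d C D \<ge> 0"
  by (simp add: hausdorff_dist_def)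

lemma hausdorff_dist_commute: "hausdorff_dist d C D = hausdorff_dist d D C"
  by (simp add: hausdorff_dist_def max.commute)

text \<open>The topology on compact sets is declared through \<open>Metric_space.mtopology\<close>;
  its open balls become usable only once the metric axioms are known.\<close>

lemma hausdorff_dist_Metric_space:
  "Metric_space {K::'a::metric_space set. compact K \<and> K \<noteq> {}} (hausdorff_dist dist)"
proof
  fix C D :: "'a set" assume "C \<in> {K. compact K \<and> K \<noteq> {}}" "D \<in> {K. compact K \<and> K \<noteq> {}}"
  then have C: "compact C" "C \<noteq> {}" and D: "compact D" "D \<noteq> {}" by auto
  have "hausdorff_dist dist C D = 0 \<longleftrightarrow> hausdorff_dist dist C D \<le> 0"
    using hausdorff_dist_nonneg[of dist C D] by linarith
  also have "\<dots> \<longleftrightarrow> C = D"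
    unfolding hausdorff_dist_le_iff[OF C D order_refl] by auto
  finally show "hausdorff_dist dist C D = 0 \<longleftrightarrow> C = D" .
next
  fix C D E :: "'a set"
  assume "C \<in> {K. compact K \<and> K \<noteq> {}}" "D \<in> {K. compact K \<and> K \<noteq> {}}" "E \<in> {K. compact K \<and> K \<noteq> {}}"
  then have C: "compact C" "C \<noteq> {}" and D: "compact D" "D \<noteq> {}" and E: "compact E" "E \<noteq> {}" by auto
  define a b where "a = hausdorff_dist dist C D" and "b = hausdorff_dist dist D E"
  have ab: "a \<ge> 0" "b \<ge> 0" by (auto simp: a_def b_def hausdorff_dist_nonneg)
  have CD: "\<forall>x\<in>C. \<exists>y\<in>D. dist x y \<le> a" "\<forall>y\<in>D. \<exists>x\<in>C. dist x y \<le> a"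
    using hausdorff_dist_le_iff[OF C D ab(1)] by (auto simp: a_def)
  have DE: "\<forall>x\<in>D. \<exists>y\<in>E. dist x y \<le> b" "\<forall>y\<in>E. \<exists>x\<in>D. dist x y \<le> b"
    using hausdorff_dist_le_iff[OF D E ab(2)] by (auto simp: b_def)
  have "\<exists>y\<in>E. dist x y \<le> a + b" if "x \<in> C" for x
    using CD(1) DE(1) that by (meson add_mono dist_triangle order_trans)
  moreover have "\<exists>x\<in>C. dist x y \<le> a + b" if "y \<in> E" for y
    using CD(2) DE(2) that by (meson add_mono dist_triangle order_trans)
  ultimately have "hausdorff_dist dist C E \<le> a + b"
    using hausdorff_dist_le_iff[OF C E] ab by simp
  then show "hausdorff_dist dist C E \<le> hausdorff_dist dist C D + hausdorff_dist dist D E"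
    by (simp add: a_def b_def)
qed (auto simp: hausdorff_dist_nonneg hausdorff_dist_commute)

text \<open>For continuous fibers, a point of the attractor over a nearby base point can be
  exchanged for one over the given base point, at a cost uniform over the compact base. This is what
  permits inflation \<open>0\<close>.\<close>

lemma fiber_uniformly_close:
  fixes A :: "('w \<times> 'a::metric_space) set"
  assumes metric: "Metric_space \<Omega> d"
    and comp: "compactin (Metric_space.mtopology \<Omega> d) \<Omega>"
    and cont: "continuous_map (Metric_space.mtopology \<Omega> d) compacts_topology (fiber A)" and \<sigma>: "\<sigma> > 0"
  obtains \<delta> where "\<delta> > 0" "\<And>\<omega> \<omega>' x. \<omega> \<in> \<Omega> \<Longrightarrow> \<omega>' \<in> \<Omega> \<Longrightarrow> d \<omega> \<omega>' < \<delta> \<Longrightarrow> x \<in> fiber A \<omega>' \<Longrightarrow>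
      \<exists>y\<in>fiber A \<omega>. dist x y \<le> \<sigma>"
proof -
  interpret Metric_space \<Omega> d by (rule metric)
  interpret H: Metric_space "{K::'a set. compact K \<and> K \<noteq> {}}" "hausdorff_dist dist"
    by (rule hausdorff_dist_Metric_space)
  have top: "compacts_topology = (H.mtopology :: 'a set topology)"
    by (simp add: compacts_topology_def)
  \<comment> \<open>The target space consists of nonempty compact sets, so continuity of the fiber
    map already carries this information.\<close>
  have fib: "compact (fiber A \<omega>) \<and> fiber A \<omega> \<noteq> {}" if "\<omega> \<in> \<Omega>" for \<omega>
    using continuous_map_image_subset_topspace[OF cont] that unfolding top by (auto simp: image_subset_iff)
  define W where "W \<omega> = {\<omega>' \<in> topspace mtopology. fiber A \<omega>' \<in> H.mball (fiber A \<omega>) (\<sigma> / 2)}" for \<omega>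
  have W: "openin mtopology (W \<omega>) \<and> \<omega> \<in> W \<omega>" if "\<omega> \<in> \<Omega>" for \<omega>
  proof
    show "openin mtopology (W \<omega>)"
      unfolding W_def by (rule openin_continuous_map_preimage[OF cont]) (simp add: top)
    show "\<omega> \<in> W \<omega>" using that \<sigma> fib[OF that] by (simp add: W_def)
  qed
  obtain \<delta> where \<delta>: "\<delta> > 0" "\<And>x y. x \<in> \<Omega> \<Longrightarrow> y \<in> \<Omega> \<Longrightarrow> d x y < \<delta> \<Longrightarrow> \<exists>z\<in>\<Omega>. x \<in> W z \<and> y \<in> W z"
    using compact_close_points_in_common_nbhd[OF comp W] by blast
  show ?thesis
  proof (rule that[OF \<delta>(1)])
    fix \<omega> \<omega>' x assume a: "\<omega> \<in> \<Omega>" "\<omega>' \<in> \<Omega>" "d \<omega> \<omega>' < \<delta>" "x \<in> fiber A \<omega>'"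
    then obtain z where z: "z \<in> \<Omega>" "\<omega> \<in> W z" "\<omega>' \<in> W z" using \<delta>(2) by blast
    have "hausdorff_dist dist (fiber A \<omega>') (fiber A \<omega>)
        \<le> hausdorff_dist dist (fiber A \<omega>') (fiber A z) + hausdorff_dist dist (fiber A z) (fiber A \<omega>)"
      by (rule H.triangle) (use fib a z in auto)
    also have "\<dots> \<le> \<sigma>"
      using z hausdorff_dist_commute[of dist "fiber A \<omega>'" "fiber A z"] by (auto simp: W_def)
    finally show "\<exists>y\<in>fiber A \<omega>. dist x y \<le> \<sigma>"
      using hausdorff_dist_le_iff[of "fiber A \<omega>'" "fiber A \<omega>" \<sigma>] fib a \<sigma> by auto
  qed
qed

section \<open>Bounds inherited by the hull\<close>

context averaging begin

text \<open>The bound is assumed for all slow times because the translate of \<open>F\<close>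
  approximating \<open>\<omega>\<close> is shifted by an unknown amount.\<close>

lemma hull_norm_le:
  assumes "\<And>\<tau> t. \<tau> \<ge> 0 \<Longrightarrow> norm (f \<tau> t x) \<le> B" and \<omega>: "\<omega> \<in> field_hull F"
  shows "norm (\<omega> (t, x)) \<le> B"
proof (rule field_le_epsilon)
  fix e :: real assume e: "e > 0"
  obtain s where s: "\<And>u y. (u, y) \<in> {(t, x)} \<Longrightarrow> dist (F (u + s, y)) (\<omega> (u, y)) < e"
    using field_hull_approx[OF \<omega> _ e, of "{(t, x)}"] by auto
  have "norm (F (t + s, x)) \<le> B" by (rule mean_norm_le) (rule assms)
  then show "norm (\<omega> (t, x)) \<le> B + e"
    using s[of t x] norm_triangle_sub[of "\<omega> (t, x)" "F (t + s, x)"] by (simp add: dist_norm norm_minus_commute)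
qed

lemma hull_diff_le:
  assumes "\<And>\<tau> t. \<tau> \<ge> 0 \<Longrightarrow> norm (f \<tau> t x - f \<tau> t y) \<le> B" and \<omega>: "\<omega> \<in> field_hull F"
  shows "norm (\<omega> (t, x) - \<omega> (t, y)) \<le> B"
proof (rule field_le_epsilon)
  fix e :: real assume e: "e > 0"
  obtain s where s: "\<And>u z. (u, z) \<in> {(t, x), (t, y)} \<Longrightarrow> dist (F (u + s, z)) (\<omega> (u, z)) < e / 2"
    using field_hull_approx[OF \<omega> _ half_gt_zero[OF e], of "{(t, x), (t, y)}"] by auto
  have "norm (F (t + s, x) - F (t + s, y)) \<le> B" by (rule mean_diff_le) (rule assms)
  moreover have "norm (F (t + s, x) - \<omega> (t, x)) < e / 2" "norm (F (t + s, y) - \<omega> (t, y)) < e / 2"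
    using s[of t x] s[of t y] by (auto simp: dist_norm)
  moreover have "\<omega> (t, x) - \<omega> (t, y) = (F (t + s, x) - F (t + s, y)) - (F (t + s, x) - \<omega> (t, x)) + (F (t + s, y) - \<omega> (t, y))"
    by simp
  ultimately show "norm (\<omega> (t, x) - \<omega> (t, y)) \<le> B + e"
    by (smt (verit) norm_triangle_ineq norm_triangle_ineq4 field_sum_of_halves)
qed

end

lemma hull_rhs_eq: "hull_rhs \<omega> t z = \<omega> (t, z)"
  by (simp add: hull_rhs_def base_field_def shift_def)

section \<open>Uniform attraction\<close>

text \<open>Equivalent to distance less than \<open>e\<close> from \<open>A\<close> in the maximum
  metric, but with an explicit witness and real instead of extended real values.\<close>

definition near :: "('w \<Rightarrow> 'w \<Rightarrow> real) \<Rightarrow> ('w \<times> 'a::metric_space) set \<Rightarrow> real \<Rightarrow> 'w \<Rightarrow> 'a \<Rightarrow> bool" where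
  "near d A e \<omega> x \<longleftrightarrow> (\<exists>\<omega>' x'. (\<omega>', x') \<in> A \<and> d \<omega> \<omega>' < e \<and> dist x x' < e)"

text \<open>Only the state moves: the averaged and the original solution are always compared over
  the same base point.\<close>

lemma near_perturb:
  assumes "near d A e \<omega> x" "dist x y \<le> \<kappa>" "e + \<kappa> \<le> e'"
  shows "near d A e' \<omega> y"
proof -
  obtain \<omega>' x' where a: "(\<omega>', x') \<in> A" "d \<omega> \<omega>' < e" "dist x x' < e"
    using assms(1) unfolding near_def by blast
  have "\<kappa> \<ge> 0" using assms(2) zero_le_dist order_trans by blast
  then have "d \<omega> \<omega>' < e'" "dist y x' < e'"
    using a assms dist_triangle3[of y x' x] by (auto simp: dist_commute)
  then show ?thesis using a(1) unfolding near_def by blast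
qed

lemma near_mono: "near d A e \<omega> x \<Longrightarrow> e \<le> e' \<Longrightarrow> near d A e' \<omega> x"
  by (rule near_perturb[of _ _ e _ x _ 0]) auto

text \<open>The semidistance is a supremum, so a single time works for all of \<open>C\<close>.
  Points whose solution is undefined at time \<open>t\<close> do not occur in the image, hence the
  domain condition.\<close>

lemma attracts_imp_near:
  assumes "attracts \<Omega> d A C" "\<eta> > 0"
  obtains T where "T > 0" "\<And>t \<omega> x. t \<ge> T \<Longrightarrow> (\<omega>, x) \<in> C \<Longrightarrow> (t, \<omega>, x) \<in> skew_dom \<Omega> \<Longrightarrow>
      near d A \<eta> (shift \<omega> t) (max_sol UNIV (hull_rhs \<omega>) 0 x t)"
proof -
  have "eventually (\<lambda>t. semidist (max_metric d) (skew_image \<Omega> t C) A < ennreal \<eta>) at_top"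
    by (rule order_tendstoD(2)[OF assms(1)[unfolded attracts_def]]) (use assms in simp)
  then obtain T0 where T0: "\<And>t. t \<ge> T0 \<Longrightarrow> semidist (max_metric d) (skew_image \<Omega> t C) A < ennreal \<eta>"
    unfolding eventually_at_top_linorder by blast
  show ?thesis
  proof (rule that[of "max T0 1"])
    fix t \<omega> x assume t: "t \<ge> max T0 1" "(\<omega>, x) \<in> C" "(t, \<omega>, x) \<in> skew_dom \<Omega>"
    have "skew_flow t (\<omega>, x) \<in> skew_image \<Omega> t C" using t unfolding skew_image_def by blast
    then have "dist_to (max_metric d) (skew_flow t (\<omega>, x)) A \<le> semidist (max_metric d) (skew_image \<Omega> t C) A"
      unfolding semidist_def by (rule SUP_upper)
    also have "\<dots> < ennreal \<eta>" using T0 t by simp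
    finally obtain a where "a \<in> A" "max_metric d (skew_flow t (\<omega>, x)) a < \<eta>"
      by (rule dist_to_less_obtain)
    then show "near d A \<eta> (shift \<omega> t) (max_sol UNIV (hull_rhs \<omega>) 0 x t)"
      unfolding near_def by (cases a) (auto simp: skew_flow_def max_metric_def)
  qed simp
qed

locale averaging_attractor = averaging f F
  for f :: "real \<Rightarrow> real \<Rightarrow> 'a \<Rightarrow> 'a::euclidean_space" and F :: "'a field" +
  fixes d :: "'a field \<Rightarrow> 'a field \<Rightarrow> real" and A :: "('a field \<times> 'a) set"
  assumes metric: "Metric_space (field_hull F) d"
    and metric_top: "Metric_space.mtopology (field_hull F) d = hull_topology (field_hull F)"
    and attractor: "local_attractor (field_hull F) d A"
    and projection: "base_projection (field_hull F) A = field_hull F"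
begin

abbreviation hull_sol :: "'a field \<Rightarrow> 'a \<Rightarrow> real \<Rightarrow> 'a" where
  "hull_sol \<omega> x \<equiv> max_sol UNIV (hull_rhs \<omega>) 0 x"

lemma hull_lipschitz:
  assumes \<omega>: "\<omega> \<in> field_hull F"
  shows "lipschitz_on_balls D (hull_rhs \<omega>)"
  unfolding lipschitz_on_balls_def hull_rhs_eq
proof
  fix r
  obtain L where L: "L \<ge> 0" "\<And>\<tau> t x y. \<tau> \<ge> 0 \<Longrightarrow> norm x \<le> r \<Longrightarrow> norm y \<le> r \<Longrightarrow>
      norm (f \<tau> t x - f \<tau> t y) \<le> L * norm (x - y)"
    using f_lip[of r] by blast
  show "\<exists>L\<ge>0. \<forall>t\<in>D. \<forall>x y. norm x \<le> r \<and> norm y \<le> r \<longrightarrow> norm (\<omega> (t, x) - \<omega> (t, y)) \<le> L * norm (x - y)"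
    using L hull_diff_le[OF _ \<omega>] by blast
qed

lemma hull_sol_solution:
  assumes \<omega>: "\<omega> \<in> field_hull F" and dom: "\<And>t. t \<ge> 0 \<Longrightarrow> (t, \<omega>, x) \<in> skew_dom (field_hull F)"
  shows "hull_sol \<omega> x 0 = x"
    and "t \<in> {0..T} \<Longrightarrow> (hull_sol \<omega> x has_vector_derivative \<omega> (t, hull_sol \<omega> x t)) (at t within {0..T})"
proof -
  have sol: "solution_on (hull_rhs \<omega>) 0 x (max_dom UNIV (hull_rhs \<omega>) 0 x) (hull_sol \<omega> x)"
    by (rule max_sol_characterisation(2)[OF hull_lipschitz[OF \<omega>]]) simp
  then show "hull_sol \<omega> x 0 = x" by (simp add: solution_on_def)
  show "(hull_sol \<omega> x has_vector_derivative \<omega> (t, hull_sol \<omega> x t)) (at t within {0..T})" if "t \<in> {0..T}"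
  proof -
    have "{0..T} \<subseteq> max_dom UNIV (hull_rhs \<omega>) 0 x" using dom by (auto simp: skew_dom_def)
    from solution_on_subset[OF sol this that] show ?thesis by (simp add: hull_rhs_eq)
  qed
qed

lemma attractor_compact: "compactin (phase_topology (field_hull F)) A"
  using attractor unfolding local_attractor_def by blast

lemma attractor_subset: "(\<omega>, x) \<in> A \<Longrightarrow> \<omega> \<in> field_hull F"
  using compactin_subset_topspace[OF attractor_compact]
  by (auto simp: phase_topology_def topspace_hull_topology)

lemma hull_compact: "compactin (hull_topology (field_hull F)) (field_hull F)"
proof -
  have "compactin (hull_topology (field_hull F)) (fst ` A)"
    by (rule image_compactin[OF attractor_compact]) (simp add: phase_topology_def continuous_map_fst)
  moreover have "fst ` A = field_hull F"
  proof
    show "fst ` A \<subseteq> field_hull F" using attractor_subset by auto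
    show "field_hull F \<subseteq> fst ` A"
    proof
      fix \<omega> assume "\<omega> \<in> field_hull F"
      then have "\<omega> \<in> base_projection (field_hull F) A" using projection by simp
      then obtain x where "(\<omega>, x) \<in> A" by (auto simp: base_projection_def fiber_def)
      then show "\<omega> \<in> fst ` A" by force
    qed
  qed
  ultimately show ?thesis by simp
qed

lemma attractor_bounded:
  obtains R where "R \<ge> 0" "\<And>\<omega> x. (\<omega>, x) \<in> A \<Longrightarrow> norm x \<le> R"
proof -
  have "compactin (euclidean :: 'a topology) (snd ` A)"
    by (rule image_compactin[OF attractor_compact]) (simp add: phase_topology_def continuous_map_snd)
  then have "bounded (snd ` A)" by (simp add: compact_imp_bounded)
  then obtain R where "R > 0" "\<And>p. p \<in> A \<Longrightarrow> norm (snd p) \<le> R"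
    unfolding bounded_pos by auto
  then show ?thesis using that[of R] by force
qed

lemma attractor_invariant:
  assumes "(\<omega>, x) \<in> A"
  shows "(t, \<omega>, x) \<in> skew_dom (field_hull F)" "(shift \<omega> t, hull_sol \<omega> x t) \<in> A"
proof -
  have inv: "UNIV \<times> A \<subseteq> skew_dom (field_hull F)" "skew_image (field_hull F) t A = A"
    using attractor unfolding local_attractor_def skew_invariant_def by blast+
  show 1: "(t, \<omega>, x) \<in> skew_dom (field_hull F)" using inv(1) assms by blast
  have "skew_flow t (\<omega>, x) \<in> skew_image (field_hull F) t A"
    using 1 assms unfolding skew_image_def by blast
  then show "(shift \<omega> t, hull_sol \<omega> x t) \<in> A" using inv(2) by (simp add: skew_flow_def)
qed

lemma near_in_closed_nbhd:
  assumes \<omega>: "\<omega> \<in> field_hull F" and near: "near d A \<mu> \<omega> x"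
  shows "(\<omega>, x) \<in> closed_nbhd (field_hull F) d \<mu> A"
proof -
  obtain \<omega>' x' where a: "(\<omega>', x') \<in> A" "d \<omega> \<omega>' < \<mu>" "dist x x' < \<mu>"
    using near unfolding near_def by blast
  have "\<mu> > 0" using a(3) zero_le_dist le_less_trans by blast
  then have "ennreal (max_metric d (\<omega>, x) (\<omega>', x')) < ennreal \<mu>"
    using a by (intro ennreal_lessI) (auto simp: max_metric_def)
  moreover have "dist_to (max_metric d) (\<omega>, x) A \<le> ennreal (max_metric d (\<omega>, x) (\<omega>', x'))"
    by (rule dist_to_le[OF a(1) order_refl])
  ultimately have "(\<omega>, x) \<in> open_nbhd (field_hull F) d \<mu> A"
    using \<omega> by (auto simp: open_nbhd_def)
  moreover have "open_nbhd (field_hull F) d \<mu> A \<subseteq> topspace (phase_topology (field_hull F))"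
    by (auto simp: open_nbhd_def phase_topology_def topspace_hull_topology)
  ultimately show ?thesis
    unfolding closed_nbhd_def using closure_of_subset by blast
qed

text \<open>Attraction alone bounds solutions only after a transient. During the transient, a
  solution starting near the attractor is compared with the orbit of a nearby attractor point, which
  stays in \<open>A\<close> by invariance and is driven by a nearby field of the hull. Shrinking the
  neighbourhood keeps the two within distance \<open>1\<close>.\<close>

lemma uniform_attraction:
  obtains \<mu> R where "\<mu> > 0" "R \<ge> 0"
    "\<And>\<omega> x t. \<omega> \<in> field_hull F \<Longrightarrow> near d A \<mu> \<omega> x \<Longrightarrow> t \<ge> 0 \<Longrightarrow>
       (t, \<omega>, x) \<in> skew_dom (field_hull F) \<and> norm (hull_sol \<omega> x t) \<le> R"
    "\<And>\<eta>. \<eta> > 0 \<Longrightarrow> \<exists>T>0. \<forall>\<omega> x t. \<omega> \<in> field_hull F \<and> near d A \<mu> \<omega> x \<and> t \<ge> T \<longrightarrow>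
       near d A \<eta> (shift \<omega> t) (hull_sol \<omega> x t)"
proof -
  obtain \<mu>1 where \<mu>1: "\<mu>1 > 0" "{0..} \<times> closed_nbhd (field_hull F) d \<mu>1 A \<subseteq> skew_dom (field_hull F)"
      "attracts (field_hull F) d A (closed_nbhd (field_hull F) d \<mu>1 A)"
    using attractor unfolding local_attractor_def by blast
  have dom: "(t, \<omega>, x) \<in> skew_dom (field_hull F)" if "\<omega> \<in> field_hull F" "near d A \<mu>1 \<omega> x" "t \<ge> 0" for t \<omega> x
    using \<mu>1(2) near_in_closed_nbhd[OF that(1,2)] that(3) by auto
  have attr: "\<exists>T>0. \<forall>\<omega> x t. \<omega> \<in> field_hull F \<and> near d A \<mu>1 \<omega> x \<and> t \<ge> T \<longrightarrow>
       near d A \<eta> (shift \<omega> t) (hull_sol \<omega> x t)" if pos: "\<eta> > 0" for \<eta>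
  proof -
    obtain T where T: "T > 0" "\<And>t \<omega> x. t \<ge> T \<Longrightarrow> (\<omega>, x) \<in> closed_nbhd (field_hull F) d \<mu>1 A \<Longrightarrow>
        (t, \<omega>, x) \<in> skew_dom (field_hull F) \<Longrightarrow> near d A \<eta> (shift \<omega> t) (hull_sol \<omega> x t)"
      by (rule attracts_imp_near[OF \<mu>1(3) pos]) (rule that)
    show ?thesis
    proof (intro exI conjI allI impI, rule T(1), elim conjE)
      fix \<omega> x t assume a: "\<omega> \<in> field_hull F" "near d A \<mu>1 \<omega> x" "T \<le> t"
      show "near d A \<eta> (shift \<omega> t) (hull_sol \<omega> x t)"
        by (rule T(2)[OF a(3) near_in_closed_nbhd[OF a(1,2)] dom[OF a(1,2)]]) (use a T(1) in simp)
    qed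
  qed
  obtain RA where RA: "RA \<ge> 0" "\<And>\<omega> x. (\<omega>, x) \<in> A \<Longrightarrow> norm x \<le> RA"
    using attractor_bounded by blast
  obtain T where T: "T > 0" "\<And>\<omega> x t. \<omega> \<in> field_hull F \<Longrightarrow> near d A \<mu>1 \<omega> x \<Longrightarrow> t \<ge> T \<Longrightarrow>
       near d A 1 (shift \<omega> t) (hull_sol \<omega> x t)"
    using attr[OF zero_less_one] by blast
  obtain M where M: "M \<ge> 0" "\<And>\<tau> t x. \<tau> \<ge> 0 \<Longrightarrow> norm x \<le> RA + 1 \<Longrightarrow> norm (f \<tau> t x) \<le> M"
    using f_bound[of "RA + 1"] by blast
  obtain L where L: "L \<ge> 0" "\<And>\<tau> t x y. \<tau> \<ge> 0 \<Longrightarrow> norm x \<le> RA + 1 \<Longrightarrow> norm y \<le> RA + 1 \<Longrightarrow>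
      norm (f \<tau> t x - f \<tau> t y) \<le> L * norm (x - y)"
    using f_lip[of "RA + 1"] by blast
  \<comment> \<open>One share \<open>c\<close> is for the initial distance, another for the
    difference of the driving fields, which accumulates to \<open>\<eta> * T = c\<close>. The
    Gronwall factor raises their sum to exactly \<open>1\<close>.\<close>
  define c where "c = exp (- (L * T)) / 2"
  define \<eta> where "\<eta> = c / T"
  have c: "c > 0" and \<eta>: "\<eta> > 0" using T by (auto simp: c_def \<eta>_def)
  have K: "compact ({0..T} \<times> cball (0::'a) RA)" by (intro compact_Times) auto
  obtain \<mu>2 where \<mu>2: "\<mu>2 > 0" "\<And>\<omega> \<omega>' p. \<omega> \<in> field_hull F \<Longrightarrow> \<omega>' \<in> field_hull F \<Longrightarrow> d \<omega> \<omega>' < \<mu>2 \<Longrightarrow>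
      p \<in> {0..T} \<times> cball 0 RA \<Longrightarrow> dist (\<omega> p) (\<omega>' p) \<le> \<eta>"
    by (rule field_hull_uniformly_close[OF metric metric_top hull_compact K \<eta>]) (rule that)
  define \<mu> where "\<mu> = min \<mu>1 (min \<mu>2 c)"
  have \<mu>: "\<mu> > 0" "\<mu> \<le> \<mu>1" "\<mu> \<le> \<mu>2" "\<mu> \<le> c" using \<mu>1(1) \<mu>2(1) c by (auto simp: \<mu>_def)
  show ?thesis
  proof (rule that[of \<mu> "RA + 1"])
    show "\<mu> > 0" "RA + 1 \<ge> 0" using \<mu> RA by auto
    show "\<exists>T>0. \<forall>\<omega> x t. \<omega> \<in> field_hull F \<and> near d A \<mu> \<omega> x \<and> t \<ge> T \<longrightarrow>
       near d A \<eta> (shift \<omega> t) (hull_sol \<omega> x t)" if pos: "\<eta> > 0" for \<eta>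
    proof -
      obtain T where T: "T > 0" "\<And>\<omega> x t. \<omega> \<in> field_hull F \<Longrightarrow> near d A \<mu>1 \<omega> x \<Longrightarrow> t \<ge> T \<Longrightarrow>
          near d A \<eta> (shift \<omega> t) (hull_sol \<omega> x t)"
        using attr[OF pos] by blast
      show ?thesis
        by (intro exI conjI allI impI, rule T(1), elim conjE) (rule T(2)[OF _ near_mono[OF _ \<mu>(2)]])
    qed
    fix \<omega> x t assume \<omega>: "\<omega> \<in> field_hull F" and nr: "near d A \<mu> \<omega> x" and t: "(t::real) \<ge> 0"
    have nr1: "near d A \<mu>1 \<omega> x" using near_mono[OF nr \<mu>(2)] .
    have "norm (hull_sol \<omega> x t) \<le> RA + 1"
    proof (cases "t \<ge> T")
      case True
      obtain \<omega>' x' where "(\<omega>', x') \<in> A" "dist (hull_sol \<omega> x t) x' < 1"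
        using T(2)[OF \<omega> nr1 True] unfolding near_def by blast
      then show ?thesis
        using RA(2)[of \<omega>' x'] norm_triangle_sub[of "hull_sol \<omega> x t" x'] by (simp add: dist_norm)
    next
      case False
      obtain \<omega>' x' where a: "(\<omega>', x') \<in> A" "d \<omega> \<omega>' < \<mu>" "dist x x' < \<mu>"
        using nr unfolding near_def by blast
      note \<omega>' = attractor_subset[OF a(1)]
      note sol = hull_sol_solution[OF \<omega> dom[OF \<omega> nr1]]
      note sol' = hull_sol_solution[OF \<omega>' attractor_invariant(1)[OF a(1)]]
      show ?thesis
      proof (rule solution_stays_bounded[where g = "hull_rhs \<omega>" and h = "hull_rhs \<omega>'" and w = "hull_sol \<omega>' x'"
            and T = T and L = L and \<eta> = \<eta> and M = M and r = RA])
        show "continuous_on ({0..} \<times> cball 0 (RA + 1)) (\<lambda>(t, x). hull_rhs \<omega> t x)"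
          unfolding hull_rhs_eq using field_hull_continuous[OF \<omega>] by (auto intro: continuous_on_subset)
        show "norm (hull_rhs \<omega> t x - hull_rhs \<omega> t y) \<le> L * norm (x - y)"
          if "norm x \<le> RA + 1" "norm y \<le> RA + 1" for t x y
          unfolding hull_rhs_eq by (rule hull_diff_le[OF _ \<omega>]) (use L that in auto)
        show "norm (hull_rhs \<omega> t x) \<le> M" if "norm x \<le> RA + 1" for t x
          unfolding hull_rhs_eq by (rule hull_norm_le[OF _ \<omega>]) (use M that in auto)
        show "lipschitz_on_balls {0..} (hull_rhs \<omega>)" by (rule hull_lipschitz[OF \<omega>])
        show "(hull_sol \<omega> x has_vector_derivative hull_rhs \<omega> t (hull_sol \<omega> x t)) (at t within {0..T})"
          if "t \<in> {0..T}" for t using sol(2)[OF _ that] by (simp add: hull_rhs_eq)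
        show "(hull_sol \<omega>' x' has_vector_derivative hull_rhs \<omega>' t (hull_sol \<omega>' x' t)) (at t within {0..T})"
          if "t \<in> {0..T}" for t using sol'(2)[OF that] by (simp add: hull_rhs_eq)
        show "norm (hull_sol \<omega>' x' t) \<le> RA" for t
          using RA(2) attractor_invariant(2)[OF a(1)] by blast
        show "norm (hull_rhs \<omega> t x - hull_rhs \<omega>' t x) \<le> \<eta>" if "t \<in> {0..T}" "norm x \<le> RA" for t x
          using \<mu>2(2)[OF \<omega> \<omega>', of "(t, x)"] a(2) \<mu>(3) that by (simp add: hull_rhs_eq dist_norm)
        have "norm (hull_sol \<omega> x 0 - hull_sol \<omega>' x' 0) + \<eta> * T \<le> c + c"
          using a(3) \<mu>(4) sol(1) sol'(1) T(1) by (intro add_mono) (auto simp: dist_norm \<eta>_def)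
        then have "(norm (hull_sol \<omega> x 0 - hull_sol \<omega>' x' 0) + \<eta> * T) * exp (L * T) \<le> (c + c) * exp (L * T)"
          by (rule mult_right_mono) simp
        also have "\<dots> = 1" by (simp add: c_def exp_minus)
        finally show "(norm (hull_sol \<omega> x 0 - hull_sol \<omega>' x' 0) + \<eta> * T) * exp (L * T) \<le> 1" .
      qed (use RA T L \<eta> t False in auto)
    qed
    then show "(t, \<omega>, x) \<in> skew_dom (field_hull F) \<and> norm (hull_sol \<omega> x t) \<le> RA + 1"
      using dom[OF \<omega> nr1 t] by blast
  qed
qed

end

section \<open>Tracking of the attractor\<close>

context averaging_attractor begin

text \<open>Attraction of compact subsets of the basin is applied to the singleton containing the
  initial point.\<close>

lemma basin_attraction:
  assumes basin: "(F, x0) \<in> basin_of_attraction (field_hull F) d A" and \<eta>: "\<eta> > 0"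
  obtains s where "s > 0" "near d A \<eta> (shift F s) (hull_sol F x0 s)"
    "\<And>t. t \<ge> 0 \<Longrightarrow> (t, F, x0) \<in> skew_dom (field_hull F)"
proof -
  obtain U where U: "attraction_open_set (field_hull F) d A U" "(F, x0) \<in> U"
    using basin unfolding basin_of_attraction_def by blast
  have op: "openin (phase_topology (field_hull F)) U" and dom: "{0..} \<times> U \<subseteq> skew_dom (field_hull F)"
    and attr: "\<And>K. compactin (phase_topology (field_hull F)) K \<Longrightarrow> K \<subseteq> U \<Longrightarrow> attracts (field_hull F) d A K"
    using U(1) unfolding attraction_open_set_def by blast+
  have "(F, x0) \<in> topspace (phase_topology (field_hull F))" using openin_subset[OF op] U(2) by blast
  then have at: "attracts (field_hull F) d A {(F, x0)}" using U(2) by (intro attr) auto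
  have 1: "(t, F, x0) \<in> skew_dom (field_hull F)" if "t \<ge> 0" for t using dom U(2) that by auto
  obtain s where s: "s > 0" "\<And>t \<omega> x. t \<ge> s \<Longrightarrow> (\<omega>, x) \<in> {(F, x0)} \<Longrightarrow> (t, \<omega>, x) \<in> skew_dom (field_hull F) \<Longrightarrow>
      near d A \<eta> (shift \<omega> t) (hull_sol \<omega> x t)"
    by (rule attracts_imp_near[OF at \<eta>]) (rule that)
  have "near d A \<eta> (shift F s) (hull_sol F x0 s)" by (rule s(2)) (use s(1) 1 in auto)
  then show ?thesis using that s(1) 1 by blast
qed

text \<open>Hull solutions start at time \<open>0\<close>; moving the origin to \<open>a\<close>
  makes them solutions of the averaged equation in the time variable of the original
  problem.\<close>

lemma shifted_hull_sol:
  assumes dom: "\<And>t. t \<ge> 0 \<Longrightarrow> (t, shift F a, x) \<in> skew_dom (field_hull F)"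
    and s: "s \<in> {a..a + T}"
  shows "((\<lambda>s. hull_sol (shift F a) x (s - a)) has_vector_derivative F (s, hull_sol (shift F a) x (s - a)))
    (at s within {a..a + T})"
proof -
  have "((hull_sol (shift F a) x \<circ> (\<lambda>s. s - a)) has_vector_derivative
      1 *\<^sub>R (shift F a) (s - a, hull_sol (shift F a) x (s - a))) (at s within {a..a + T})"
  proof (rule vector_diff_chain_within)
    show "((\<lambda>s. s - a) has_vector_derivative 1) (at s within {a..a + T})"
      by (auto intro!: derivative_eq_intros)
    have "(\<lambda>s. s - a) ` {a..a + T} = {0..T}" by (simp add: image_diff_atLeastAtMost)
    then show "(hull_sol (shift F a) x has_vector_derivative
        (shift F a) (s - a, hull_sol (shift F a) x (s - a))) (at (s - a) within (\<lambda>s. s - a) ` {a..a + T})"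
      using hull_sol_solution(2)[OF shift_in_field_hull[OF F_cont] dom, of "s - a" T] s by simp
  qed
  then show ?thesis by (simp add: o_def shift_def)
qed

lemma slow_cutoff_solution:
  assumes r: "r \<ge> 0" and \<epsilon>: "\<epsilon> > 0"
  obtains y where "solution_on (\<lambda>t x. f (t / \<epsilon>) t (closest_point (cball 0 r) x)) 0 x0 {0..} y"
proof -
  obtain M where M: "\<And>\<tau> t x. \<tau> \<ge> 0 \<Longrightarrow> norm x \<le> r \<Longrightarrow> norm (f \<tau> t x) \<le> M"
    using f_bound[of r] by blast
  obtain L where L: "L \<ge> 0" "\<And>\<tau> t x y. \<tau> \<ge> 0 \<Longrightarrow> norm x \<le> r \<Longrightarrow> norm y \<le> r \<Longrightarrow>
      norm (f \<tau> t x - f \<tau> t y) \<le> L * norm (x - y)"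
    using f_lip[of r] by blast
  have "continuous_on ({0..} \<times> cball 0 r) ((\<lambda>(\<tau>, t, x). f \<tau> t x) \<circ> (\<lambda>(t, x). (t / \<epsilon>, t, x)))"
    unfolding case_prod_unfold
    by (intro continuous_on_compose continuous_intros continuous_on_subset[OF f_cont[of r, unfolded case_prod_unfold]])
       (use \<epsilon> in auto)
  then have "continuous_on ({0..} \<times> cball 0 r) (\<lambda>(t, x). f (t / \<epsilon>) t x)"
    by (simp add: o_def case_prod_unfold)
  then show ?thesis
    by (rule cutoff_solution_exists[where M = M, OF r L(1)]) (use L(2) M \<epsilon> that in auto)
qed

lemma attractor_tracking:
  assumes basin: "(F, x0) \<in> basin_of_attraction (field_hull F) d A" and \<eta>: "\<eta> > 0"
  obtains t0 \<epsilon>0 where "t0 > 0" "\<epsilon>0 > 0"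
    "\<And>\<epsilon>. 0 < \<epsilon> \<Longrightarrow> \<epsilon> < \<epsilon>0 \<Longrightarrow> \<exists>y. solution_on (slow_rhs f \<epsilon>) 0 x0 {0..} y \<and>
       (\<forall>t\<ge>t0. near d A \<eta> (shift F t) (y t))"
proof -
  note inF = shift_in_field_hull[OF F_cont]
  have F0: "shift F 0 = F" by (simp add: shift_def)
  obtain \<mu> R where \<mu>: "\<mu> > 0" and R: "R \<ge> 0"
    and stay: "\<And>\<omega> x t. \<omega> \<in> field_hull F \<Longrightarrow> near d A \<mu> \<omega> x \<Longrightarrow> t \<ge> 0 \<Longrightarrow>
       (t, \<omega>, x) \<in> skew_dom (field_hull F) \<and> norm (hull_sol \<omega> x t) \<le> R"
    and attr: "\<And>\<eta>. \<eta> > 0 \<Longrightarrow> \<exists>T>0. \<forall>\<omega> x t. \<omega> \<in> field_hull F \<and> near d A \<mu> \<omega> x \<and> t \<ge> T \<longrightarrow>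
       near d A \<eta> (shift \<omega> t) (hull_sol \<omega> x t)"
    by (rule uniform_attraction) (rule that)
  \<comment> \<open>Only half of \<open>\<mu>\<close> is demanded from the averaged solution; the
    other half is left for the averaging error on \<open>{0..s0}\<close>.\<close>
  obtain s0 where s0: "s0 > 0" "near d A (\<mu> / 2) (shift F s0) (hull_sol F x0 s0)"
      "\<And>t. t \<ge> 0 \<Longrightarrow> (t, F, x0) \<in> skew_dom (field_hull F)"
    by (rule basin_attraction[OF basin half_gt_zero[OF \<mu>]]) (rule that)
  note sol0 = shifted_hull_sol[of 0 x0, unfolded F0, OF s0(3), simplified]
  have "continuous_on {0..s0} (hull_sol F x0)"
    using sol0 by (meson continuous_on_eq_continuous_within has_vector_derivative_continuous atLeastAtMost_iff)
  then have "bounded (hull_sol F x0 ` {0..s0})"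
    by (intro compact_imp_bounded compact_continuous_image) auto
  then obtain R0 where R0: "\<And>t. t \<in> {0..s0} \<Longrightarrow> norm (hull_sol F x0 t) \<le> R0"
    unfolding bounded_iff by blast
  \<comment> \<open>\<open>R0\<close> bounds the initial averaged solution and \<open>R\<close> all
    restarted ones; the margin \<open>1\<close> accommodates the error
    \<open>\<kappa> \<le> 1\<close>, so the truncated solution never leaves the ball.\<close>
  define r where "r = max R R0 + 1"
  have r: "r \<ge> 0" "R \<le> r" "R0 \<le> r" "R + 1 \<le> r" "R0 + 1 \<le> r" using R by (auto simp: r_def)
  define \<eta>' where "\<eta>' = min \<eta> \<mu>"
  have \<eta>': "\<eta>' > 0" "\<eta>' \<le> \<eta>" "\<eta>' \<le> \<mu>" using \<eta> \<mu> by (auto simp: \<eta>'_def)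
  obtain T where T: "T > 0" "\<And>\<omega> x t. \<omega> \<in> field_hull F \<Longrightarrow> near d A \<mu> \<omega> x \<Longrightarrow> t \<ge> T \<Longrightarrow>
       near d A (\<eta>' / 2) (shift \<omega> t) (hull_sol \<omega> x t)"
    using attr[OF half_gt_zero[OF \<eta>'(1)]] by blast
  \<comment> \<open>Averaged solutions come within \<open>\<eta>' / 2\<close> of the attractor, so
    this error still leaves the original one within \<open>\<eta>'\<close>.\<close>
  define \<kappa> where "\<kappa> = min (\<eta>' / 2) 1"
  have \<kappa>: "\<kappa> > 0" "\<kappa> \<le> \<eta>' / 2" "\<kappa> \<le> 1" "\<kappa> \<le> \<mu> / 2" using \<eta>' by (auto simp: \<kappa>_def)
  have s0': "s0 \<ge> 0" and T2: "2 * T \<ge> 0" using s0 T by auto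
  let ?est = "\<lambda>S \<epsilon>0. \<forall>\<epsilon> a y v t. 0 < \<epsilon> \<and> \<epsilon> < \<epsilon>0 \<and> a \<ge> 0 \<and>
      (\<forall>s\<in>{a..a+S}. (y has_vector_derivative f (s / \<epsilon>) s (closest_point (cball 0 r) (y s)))
          (at s within {a..a+S})) \<and>
      (\<forall>s\<in>{a..a+S}. (v has_vector_derivative F (s, v s)) (at s within {a..a+S})) \<and>
      (\<forall>s\<in>{a..a+S}. norm (v s) \<le> r) \<and> y a = v a \<and> t \<in> {a..a+S} \<longrightarrow> norm (y t - v t) \<le> \<kappa>"
  have est: "\<exists>\<epsilon>0>0. ?est S \<epsilon>0" if S: "S \<ge> 0" for S
    by (rule averaging_estimate[OF r(1) S \<kappa>(1)]) blast
  obtain \<epsilon>1 where \<epsilon>1: "\<epsilon>1 > 0" "?est s0 \<epsilon>1" using est[OF s0'] by blast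
  obtain \<epsilon>2 where \<epsilon>2: "\<epsilon>2 > 0" "?est (2 * T) \<epsilon>2" using est[OF T2] by blast
  show ?thesis
  proof (rule that[of "s0 + T" "min \<epsilon>1 \<epsilon>2"])
    show "s0 + T > 0" "min \<epsilon>1 \<epsilon>2 > 0" using s0 T \<epsilon>1 \<epsilon>2 by auto
    fix \<epsilon> :: real assume \<epsilon>: "0 < \<epsilon>" "\<epsilon> < min \<epsilon>1 \<epsilon>2"
    obtain y where y: "solution_on (\<lambda>t x. f (t / \<epsilon>) t (closest_point (cball 0 r) x)) 0 x0 {0..} y"
      by (rule slow_cutoff_solution[OF r(1) \<epsilon>(1)]) (rule that)
    have yder: "(y has_vector_derivative f (s / \<epsilon>) s (closest_point (cball 0 r) (y s))) (at s within {a..b})"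
      if "a \<ge> 0" "s \<in> {a..b}" for a b s
      by (rule solution_on_subset[OF y _ that(2)]) (use that(1) in auto)
    have y0: "y 0 = x0" using y by (simp add: solution_on_def)
    have start: "norm (y t - hull_sol F x0 t) \<le> \<kappa>" if t: "t \<in> {0..s0}" for t
    proof -
      have "y 0 = hull_sol F x0 0"
        using hull_sol_solution(1)[OF inF[of 0, unfolded F0] s0(3)] y0 by simp
      moreover have "norm (hull_sol F x0 s) \<le> r" if "s \<in> {0..s0}" for s
        using R0[OF that] r(3) by simp
      ultimately show ?thesis
        using \<epsilon>1(2)[rule_format, of \<epsilon> 0 y "hull_sol F x0" t] \<epsilon> yder[of 0 _ s0] sol0 t by auto
    qed
    have start_near: "near d A \<mu> (shift F s0) (y s0)"
      by (rule near_perturb[OF s0(2), of _ \<kappa>]) (use start[of s0] s0' \<kappa> in \<open>auto simp: dist_norm norm_minus_commute\<close>)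
    have start_bound: "norm (y t) \<le> r" if "t \<in> {0..s0}" for t
      using start[OF that] R0[OF that] \<kappa> r norm_triangle_sub[of "y t" "hull_sol F x0 t"] by linarith
    have window: "(\<forall>s\<in>{a..a + 2 * T}. norm (y s) \<le> r) \<and> (\<forall>s\<in>{a + T..a + 2 * T}. near d A \<eta>' (shift F s) (y s))"
      if a: "a \<ge> 0" and nr: "near d A \<mu> (shift F a) (y a)" for a
    proof -
      \<comment> \<open>The averaged solution restarts from the current value of \<open>y\<close>,
        so the initial error of every window is zero.\<close>
      define v where "v s = hull_sol (shift F a) (y a) (s - a)" for s
      note dom = stay[OF inF nr, THEN conjunct1]
      have vR: "norm (v s) \<le> R" if "s \<ge> a" for s
        unfolding v_def using stay[OF inF nr, of "s - a"] that by simp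
      have va: "y a = v a" unfolding v_def using hull_sol_solution(1)[OF inF dom] by simp
      have vder: "(v has_vector_derivative F (s, v s)) (at s within {a..a + 2 * T})" if "s \<in> {a..a + 2 * T}" for s
        unfolding v_def by (rule shifted_hull_sol[OF dom that])
      have close: "norm (y s - v s) \<le> \<kappa>" if "s \<in> {a..a + 2 * T}" for s
      proof (rule \<epsilon>2(2)[rule_format, of \<epsilon> a y v s], intro conjI ballI)
        show "norm (v s) \<le> r" if "s \<in> {a..a + 2 * T}" for s using vR[of s] that r(2) by auto
      qed (use \<epsilon> a yder[OF a] vder va that in auto)
      show ?thesis
      proof (intro conjI ballI)
        fix s assume s: "s \<in> {a..a + 2 * T}"
        show "norm (y s) \<le> r"
          using close[OF s] vR[of s] s \<kappa> r norm_triangle_sub[of "y s" "v s"] by auto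
      next
        fix s assume s: "s \<in> {a + T..a + 2 * T}"
        then have "near d A (\<eta>' / 2) (shift (shift F a) (s - a)) (v s)"
          unfolding v_def by (intro T(2) inF nr) auto
        moreover have "shift (shift F a) (s - a) = shift F s" by (simp add: shift_def add.assoc)
        ultimately have "near d A (\<eta>' / 2) (shift F s) (v s)" by simp
        then show "near d A \<eta>' (shift F s) (y s)"
          by (rule near_perturb[of _ _ _ _ _ _ \<kappa>])
             (use close[of s] s T \<kappa> in \<open>auto simp: dist_norm norm_minus_commute\<close>)
      qed
    qed
    \<comment> \<open>The midpoint of each window is the next starting time;
      \<open>\<eta>' \<le> \<mu>\<close> guarantees that the restart condition holds again.\<close>
    have grid: "near d A \<mu> (shift F (s0 + k * T)) (y (s0 + k * T))" for k :: nat
    proof (induction k)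
      case (Suc k)
      have "s0 + k * T \<ge> 0" using s0' T by simp
      from window[OF this Suc] have "near d A \<eta>' (shift F (s0 + k * T + T)) (y (s0 + k * T + T))"
        using T by simp
      then show ?case using near_mono[OF _ \<eta>'(3)] by (simp add: algebra_simps)
    qed (use start_near in simp)
    have cell: "\<exists>k::nat. t \<in> {s0 + k * T..s0 + k * T + T}" if "t \<ge> s0" for t
    proof -
      define k where "k = nat \<lfloor>(t - s0) / T\<rfloor>"
      have "(t - s0) / T \<ge> 0" using that T by simp
      then have "real k \<le> (t - s0) / T" "(t - s0) / T \<le> real k + 1"
        unfolding k_def by (auto simp: of_nat_nat)
      then show ?thesis using T by (intro exI[of _ k]) (auto simp: field_simps)
    qed
    have bound: "norm (y t) \<le> r" if "t \<ge> 0" for t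
    proof (cases "t \<le> s0")
      case True
      then show ?thesis using start_bound that by simp
    next
      case False
      then obtain k :: nat where k: "t \<in> {s0 + k * T..s0 + k * T + T}" using cell[of t] by auto
      have "s0 + k * T \<ge> 0" using s0' T by simp
      from window[OF this grid] k T show ?thesis by auto
    qed
    \<comment> \<open>Choosing the cell of \<open>t - T\<close> instead of that of \<open>t\<close>
      places \<open>t\<close> in the second half of a window, where the attraction has already
      acted.\<close>
    have late: "near d A \<eta> (shift F t) (y t)" if t: "t \<ge> s0 + T" for t
    proof -
      obtain k :: nat where k: "t - T \<in> {s0 + k * T..s0 + k * T + T}" using cell[of "t - T"] t by auto
      have "s0 + k * T \<ge> 0" using s0' T by simp
      from window[OF this grid] k T have "near d A \<eta>' (shift F t) (y t)" by auto
      then show ?thesis by (rule near_mono[OF _ \<eta>'(2)])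
    qed
    \<comment> \<open>By the global bound the projection fixes every value of \<open>y\<close>, so
      the truncation disappears from the equation.\<close>
    have "solution_on (slow_rhs f \<epsilon>) 0 x0 {0..} y"
      using y closest_point_cball(3)[OF r(1) bound] unfolding solution_on_def slow_rhs_def by simp
    then show "\<exists>y. solution_on (slow_rhs f \<epsilon>) 0 x0 {0..} y \<and> (\<forall>t\<ge>s0 + T. near d A \<eta> (shift F t) (y t))"
      using late by blast
  qed
qed

end

section \<open>Maximal solutions in slow and fast time\<close>

lemma global_solution_max_sol:
  fixes g :: "real \<Rightarrow> 'a \<Rightarrow> 'a::euclidean_space"
  assumes lip: "lipschitz_on_balls {0..} g" and sol: "solution_on g 0 x0 {0..} y"
  shows "{0..} \<subseteq> max_dom {0..} g 0 x0" and "t \<ge> 0 \<Longrightarrow> max_sol {0..} g 0 x0 t = y t"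
proof -
  have "{0..} \<subseteq> max_dom {0..} g 0 x0 \<and> (\<forall>t\<in>{0..}. max_sol {0..} g 0 x0 t = y t)"
    by (rule max_sol_characterisation(3)[OF lip _ order_refl sol]) simp
  then show "{0..} \<subseteq> max_dom {0..} g 0 x0" "t \<ge> 0 \<Longrightarrow> max_sol {0..} g 0 x0 t = y t" by auto
qed

text \<open>Rescaling time makes the factor \<open>\<epsilon>\<close> appear through the chain rule.
  With the Lipschitz bound for \<open>fast_rhs\<close>, the rescaled global solution is recognised
  as the maximal one, which gives the fast version of every estimate.\<close>

lemma solution_on_fast_time:
  assumes \<epsilon>: "\<epsilon> > 0" and sol: "solution_on (slow_rhs f \<epsilon>) 0 x0 {0..} y"
  shows "solution_on (fast_rhs f \<epsilon>) 0 x0 {0..} (\<lambda>\<tau>. y (\<epsilon> * \<tau>))"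
proof -
  have "((\<lambda>\<tau>. y (\<epsilon> * \<tau>)) has_vector_derivative fast_rhs f \<epsilon> \<tau> (y (\<epsilon> * \<tau>))) (at \<tau> within {0..})"
    if \<tau>: "\<tau> \<ge> 0" for \<tau>
  proof -
    have "((y \<circ> (\<lambda>\<tau>. \<epsilon> * \<tau>)) has_vector_derivative \<epsilon> *\<^sub>R slow_rhs f \<epsilon> (\<epsilon> * \<tau>) (y (\<epsilon> * \<tau>))) (at \<tau> within {0..})"
    proof (rule vector_diff_chain_within)
      show "((\<lambda>\<tau>. \<epsilon> * \<tau>) has_vector_derivative \<epsilon>) (at \<tau> within {0..})"
        by (auto intro!: derivative_eq_intros)
      show "(y has_vector_derivative slow_rhs f \<epsilon> (\<epsilon> * \<tau>) (y (\<epsilon> * \<tau>)))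
          (at (\<epsilon> * \<tau>) within (\<lambda>\<tau>. \<epsilon> * \<tau>) ` {0..})"
        by (rule solution_on_subset[OF sol]) (use \<epsilon> \<tau> in auto)
    qed
    then show ?thesis using \<epsilon> by (simp add: o_def fast_rhs_def slow_rhs_def)
  qed
  then show ?thesis using sol by (simp add: solution_on_def is_interval_ci)
qed

context averaging begin

lemma slow_rhs_lipschitz:
  assumes \<epsilon>: "\<epsilon> > 0"
  shows "lipschitz_on_balls {0..} (slow_rhs f \<epsilon>)"
  unfolding lipschitz_on_balls_def
proof
  fix r
  obtain L where L: "L \<ge> 0" "\<And>\<tau> t x y. \<tau> \<ge> 0 \<Longrightarrow> norm x \<le> r \<Longrightarrow> norm y \<le> r \<Longrightarrow>
      norm (f \<tau> t x - f \<tau> t y) \<le> L * norm (x - y)"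
    using f_lip[of r] by blast
  show "\<exists>L\<ge>0. \<forall>t\<in>{0..}. \<forall>x y. norm x \<le> r \<and> norm y \<le> r \<longrightarrow>
          norm (slow_rhs f \<epsilon> t x - slow_rhs f \<epsilon> t y) \<le> L * norm (x - y)"
    using L \<epsilon> by (intro exI[of _ L]) (auto simp: slow_rhs_def)
qed

lemma fast_rhs_lipschitz:
  assumes \<epsilon>: "\<epsilon> > 0"
  shows "lipschitz_on_balls {0..} (fast_rhs f \<epsilon>)"
  unfolding lipschitz_on_balls_def
proof
  fix r
  obtain L where L: "L \<ge> 0" "\<And>\<tau> t x y. \<tau> \<ge> 0 \<Longrightarrow> norm x \<le> r \<Longrightarrow> norm y \<le> r \<Longrightarrow>
      norm (f \<tau> t x - f \<tau> t y) \<le> L * norm (x - y)"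
    using f_lip[of r] by blast
  have "norm (fast_rhs f \<epsilon> t x - fast_rhs f \<epsilon> t y) \<le> \<epsilon> * L * norm (x - y)"
    if "t \<ge> 0" "norm x \<le> r" "norm y \<le> r" for t x y
    using L(2)[OF that, of "\<epsilon> * t"] \<epsilon>
    by (simp add: fast_rhs_def mult.assoc flip: scaleR_right_diff_distrib)
  then show "\<exists>L\<ge>0. \<forall>t\<in>{0..}. \<forall>x y. norm x \<le> r \<and> norm y \<le> r \<longrightarrow>
          norm (fast_rhs f \<epsilon> t x - fast_rhs f \<epsilon> t y) \<le> L * norm (x - y)"
    using L(1) \<epsilon> by (intro exI[of _ "\<epsilon> * L"]) auto
qed

end

context averaging_attractor begin

text \<open>The target family \<open>S\<close> is left abstract so that inflated and exact fibers
  are treated alike; each conclusion reduces to a static statement about points near the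
  attractor.\<close>

lemma averaged_solutions_track:
  assumes basin: "(F, x0) \<in> basin_of_attraction (field_hull F) d A" and \<eta>: "\<eta> > 0"
    and S: "\<And>\<omega> y. \<omega> \<in> field_hull F \<Longrightarrow> near d A \<eta> \<omega> y \<Longrightarrow> dist_to dist y (S \<omega>) \<le> ennreal \<sigma>"
  shows "\<exists>t0>0. \<exists>\<epsilon>0>0. \<forall>\<epsilon>. 0 < \<epsilon> \<and> \<epsilon> < \<epsilon>0 \<longrightarrow>
       ({0..} \<subseteq> max_dom {0..} (slow_rhs f \<epsilon>) 0 x0 \<and>
        (\<forall>t\<ge>t0. dist_to dist (max_sol {0..} (slow_rhs f \<epsilon>) 0 x0 t) (S (shift F t)) \<le> ennreal \<sigma>)) \<and>
       ({0..} \<subseteq> max_dom {0..} (fast_rhs f \<epsilon>) 0 x0 \<and>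
        (\<forall>\<tau>\<ge>t0 / \<epsilon>. dist_to dist (max_sol {0..} (fast_rhs f \<epsilon>) 0 x0 \<tau>) (S (shift F (\<epsilon> * \<tau>))) \<le> ennreal \<sigma>))"
proof -
  obtain t0 \<epsilon>0 where t0: "t0 > 0" and \<epsilon>0: "\<epsilon>0 > 0" and track:
    "\<And>\<epsilon>. 0 < \<epsilon> \<Longrightarrow> \<epsilon> < \<epsilon>0 \<Longrightarrow> \<exists>y. solution_on (slow_rhs f \<epsilon>) 0 x0 {0..} y \<and>
       (\<forall>t\<ge>t0. near d A \<eta> (shift F t) (y t))"
    by (rule attractor_tracking[OF basin \<eta>]) (rule that)
  let ?slow = "\<lambda>\<epsilon>. {0..} \<subseteq> max_dom {0..} (slow_rhs f \<epsilon>) 0 x0 \<and>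
      (\<forall>t\<ge>t0. dist_to dist (max_sol {0..} (slow_rhs f \<epsilon>) 0 x0 t) (S (shift F t)) \<le> ennreal \<sigma>)"
  let ?fast = "\<lambda>\<epsilon>. {0..} \<subseteq> max_dom {0..} (fast_rhs f \<epsilon>) 0 x0 \<and>
      (\<forall>\<tau>\<ge>t0 / \<epsilon>. dist_to dist (max_sol {0..} (fast_rhs f \<epsilon>) 0 x0 \<tau>) (S (shift F (\<epsilon> * \<tau>))) \<le> ennreal \<sigma>)"
  have "?slow \<epsilon> \<and> ?fast \<epsilon>" if \<epsilon>: "0 < \<epsilon>" "\<epsilon> < \<epsilon>0" for \<epsilon>
  proof -
    obtain y where y: "solution_on (slow_rhs f \<epsilon>) 0 x0 {0..} y"
        and close: "\<And>t. t \<ge> t0 \<Longrightarrow> near d A \<eta> (shift F t) (y t)"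
      using track[OF \<epsilon>] by blast
    have dist_y: "dist_to dist (y t) (S (shift F t)) \<le> ennreal \<sigma>" if "t \<ge> t0" for t
      by (rule S[OF shift_in_field_hull[OF F_cont] close[OF that]])
    note slow = global_solution_max_sol[OF slow_rhs_lipschitz[OF \<epsilon>(1)] y]
    note fast = global_solution_max_sol[OF fast_rhs_lipschitz[OF \<epsilon>(1)] solution_on_fast_time[OF \<epsilon>(1) y]]
    have "dist_to dist (max_sol {0..} (fast_rhs f \<epsilon>) 0 x0 \<tau>) (S (shift F (\<epsilon> * \<tau>))) \<le> ennreal \<sigma>"
      if "\<tau> \<ge> t0 / \<epsilon>" for \<tau>
    proof -
      have le: "t0 \<le> \<epsilon> * \<tau>" using that \<epsilon>(1) by (simp add: field_simps)
      have "\<tau> \<ge> 0" using that t0 \<epsilon>(1) by (meson divide_pos_pos less_imp_le order_trans)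
      then show ?thesis using fast(2)[of \<tau>] dist_y[OF le] by simp
    qed
    moreover have "dist_to dist (max_sol {0..} (slow_rhs f \<epsilon>) 0 x0 t) (S (shift F t)) \<le> ennreal \<sigma>"
      if "t \<ge> t0" for t
      using slow(2)[of t] dist_y[OF that] that t0 by simp
    ultimately show ?thesis using slow(1) fast(1) by blast
  qed
  then show ?thesis
    by (intro exI[of _ t0] exI[of _ \<epsilon>0] conjI[OF t0] conjI[OF \<epsilon>0] allI impI) (elim conjE)
qed

end

section \<open>Tracking of inflated and exact fibers\<close>

theorem theorem4p2:
  fixes f :: "real \<Rightarrow> real \<Rightarrow> real ^ 'n \<Rightarrow> real ^ 'n"
    and fhat :: "(real ^ 'n) field"
    and d\<Omega> :: "(real ^ 'n) field \<Rightarrow> (real ^ 'n) field \<Rightarrow> real"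
    and A :: "((real ^ 'n) field \<times> (real ^ 'n)) set"
    and xhat :: "real ^ 'n"
  assumes a: "\<And>r. r > 0 \<Longrightarrow>
        bounded ((\<lambda>(\<tau>, t, x). f \<tau> t x) ` ({0..} \<times> UNIV \<times> {x. norm x \<le> r})) \<and>
        continuous_on ({0..} \<times> UNIV \<times> {x. norm x \<le> r}) (\<lambda>(\<tau>, t, x). f \<tau> t x)"
    and b: "\<And>r. r > 0 \<Longrightarrow> \<exists>\<theta> L. modulus_of_continuity \<theta> \<and> L > 0 \<and>
        (\<forall>\<tau>\<ge>0. \<forall>t1 t2 x1 x2. norm x1 \<le> r \<and> norm x2 \<le> r \<longrightarrow>
           ennreal (norm (f \<tau> t1 x1 - f \<tau> t2 x2))
             \<le> \<theta> \<bar>t1 - t2\<bar> + ennreal (L * norm (x1 - x2)))"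
    and c: "\<And>t x. ((\<lambda>T. (1 / T) *\<^sub>R integral {0..T} (\<lambda>s. f s t x)) \<longlongrightarrow> fhat (t, x)) at_top"
    and d: "\<And>r. r > 0 \<Longrightarrow>
        uniform_limit ({0..} \<times> UNIV \<times> {x. norm x \<le> r})
          (\<lambda>T (\<tau>, t, x). (1 / T) *\<^sub>R integral {\<tau>..T + \<tau>} (\<lambda>s. f s t x))
          (\<lambda>(\<tau>, t, x). fhat (t, x)) at_top"
    and hull_metric: "Metric_space (field_hull fhat) d\<Omega>"
        "Metric_space.mtopology (field_hull fhat) d\<Omega> = hull_topology (field_hull fhat)"
    and attractor: "local_attractor (field_hull fhat) d\<Omega> A"
    and projection: "base_projection (field_hull fhat) A = field_hull fhat"
    and basin: "(fhat, xhat) \<in> basin_of_attraction (field_hull fhat) d\<Omega> A"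
  shows
    "(\<forall>\<sigma>>0. \<forall>\<delta>>0. \<exists>t0>0. \<exists>\<epsilon>0>0. \<forall>\<epsilon>. 0 < \<epsilon> \<and> \<epsilon> < \<epsilon>0 \<longrightarrow>
       ({0..} \<subseteq> max_dom {0..} (slow_rhs f \<epsilon>) 0 xhat \<and>
        (\<forall>t\<ge>t0. dist_to dist (max_sol {0..} (slow_rhs f \<epsilon>) 0 xhat t)
                  (inflated_fiber (field_hull fhat) d\<Omega> A \<delta> (shift fhat t)) \<le> ennreal \<sigma>)) \<and>
       ({0..} \<subseteq> max_dom {0..} (fast_rhs f \<epsilon>) 0 xhat \<and>
        (\<forall>\<tau>\<ge>t0 / \<epsilon>. dist_to dist (max_sol {0..} (fast_rhs f \<epsilon>) 0 xhat \<tau>)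
                  (inflated_fiber (field_hull fhat) d\<Omega> A \<delta> (shift fhat (\<epsilon> * \<tau>))) \<le> ennreal \<sigma>))) \<and>
    (continuous_map (hull_topology (field_hull fhat)) compacts_topology (fiber A) \<longrightarrow>
     (\<forall>\<sigma>>0. \<exists>t0>0. \<exists>\<epsilon>0>0. \<forall>\<epsilon>. 0 < \<epsilon> \<and> \<epsilon> < \<epsilon>0 \<longrightarrow>
       ({0..} \<subseteq> max_dom {0..} (slow_rhs f \<epsilon>) 0 xhat \<and>
        (\<forall>t\<ge>t0. dist_to dist (max_sol {0..} (slow_rhs f \<epsilon>) 0 xhat t)
                  (inflated_fiber (field_hull fhat) d\<Omega> A 0 (shift fhat t)) \<le> ennreal \<sigma>)) \<and>
       ({0..} \<subseteq> max_dom {0..} (fast_rhs f \<epsilon>) 0 xhat \<and>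
        (\<forall>\<tau>\<ge>t0 / \<epsilon>. dist_to dist (max_sol {0..} (fast_rhs f \<epsilon>) 0 xhat \<tau>)
                  (inflated_fiber (field_hull fhat) d\<Omega> A 0 (shift fhat (\<epsilon> * \<tau>))) \<le> ennreal \<sigma>))))"
proof -
  have av: "averaging f fhat"
  proof
    fix r :: real
    \<comment> \<open>The assumptions speak of positive radii, the locale of all of them.\<close>
    define s where "s = max r 1"
    have s: "s > 0" "\<And>x :: real ^ 'n. norm x \<le> r \<Longrightarrow> norm x \<le> s" by (auto simp: s_def)
    show "continuous_on ({0..} \<times> UNIV \<times> cball 0 r) (\<lambda>(\<tau>, t, x). f \<tau> t x)"
      by (rule continuous_on_subset[OF conjunct2[OF a[OF s(1)]]]) (use s(2) in auto)
    obtain M where M: "M > 0" "\<And>\<tau> t x. \<tau> \<ge> 0 \<Longrightarrow> norm x \<le> s \<Longrightarrow> norm (f \<tau> t x) \<le> M"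
      using conjunct1[OF a[OF s(1)]] unfolding bounded_pos by auto
    show "\<exists>M\<ge>0. \<forall>\<tau>\<ge>0. \<forall>t x. norm x \<le> r \<longrightarrow> norm (f \<tau> t x) \<le> M"
      using M s(2) by (intro exI[of _ M]) auto
    obtain \<theta> L where \<theta>: "modulus_of_continuity \<theta>" and L: "L > 0"
      and osc: "\<And>\<tau> t1 t2 x1 x2. \<tau> \<ge> 0 \<Longrightarrow> norm x1 \<le> s \<Longrightarrow> norm x2 \<le> s \<Longrightarrow>
         ennreal (norm (f \<tau> t1 x1 - f \<tau> t2 x2)) \<le> \<theta> \<bar>t1 - t2\<bar> + ennreal (L * norm (x1 - x2))"
      using b[OF s(1)] by blast
    have mono: "mono_on {0..} \<theta>" and lim: "(\<theta> \<longlongrightarrow> 0) (at_right 0)"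
      using \<theta> by (auto simp: modulus_of_continuity_def)
    \<comment> \<open>The filter \<open>at_right 0\<close> ignores the value at \<open>0\<close>,
      but monotonicity places it below values tending to \<open>0\<close>. Equal times in
      \<open>osc\<close> then leave the pure Lipschitz bound.\<close>
    have "\<theta> 0 \<le> 0"
    proof (rule tendsto_lowerbound[OF lim])
      show "\<forall>\<^sub>F h in at_right 0. \<theta> 0 \<le> \<theta> h"
        by (auto simp: eventually_at_right_field intro!: exI[of _ 1] mono_onD[OF mono])
    qed simp
    then have \<theta>0: "\<theta> 0 = 0" by simp
    have "norm (f \<tau> t x - f \<tau> t y) \<le> L * norm (x - y)" if "\<tau> \<ge> 0" "norm x \<le> s" "norm y \<le> s" for \<tau> t x y
      using osc[OF that, of t t] \<theta>0 L by (simp add: ennreal_le_iff)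
    then show "\<exists>L\<ge>0. \<forall>\<tau>\<ge>0. \<forall>t x y. norm x \<le> r \<and> norm y \<le> r \<longrightarrow>
          norm (f \<tau> t x - f \<tau> t y) \<le> L * norm (x - y)"
      using L s(2) by (intro exI[of _ L]) auto
    show "\<exists>h>0. \<forall>\<tau>\<ge>0. \<forall>t1 t2 x. \<bar>t1 - t2\<bar> < h \<and> norm x \<le> r \<longrightarrow> norm (f \<tau> t1 x - f \<tau> t2 x) \<le> \<eta>"
      if \<eta>: "\<eta> > 0" for \<eta>
    proof -
      have "\<forall>\<^sub>F h in at_right 0. \<theta> h < ennreal \<eta>"
        by (rule order_tendstoD(2)[OF lim]) (use \<eta> in simp)
      then obtain h where h: "h > 0" "\<And>u. 0 < u \<Longrightarrow> u < h \<Longrightarrow> \<theta> u < ennreal \<eta>"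
        unfolding eventually_at_right_field by auto
      have "norm (f \<tau> t1 x - f \<tau> t2 x) \<le> \<eta>" if "\<tau> \<ge> 0" "\<bar>t1 - t2\<bar> < h" "norm x \<le> r" for \<tau> t1 t2 x
      proof (cases "t1 = t2")
        case True
        then show ?thesis using \<eta> by simp
      next
        case False
        then have "\<theta> \<bar>t1 - t2\<bar> \<le> ennreal \<eta>" using h(2)[of "\<bar>t1 - t2\<bar>"] that(2) by simp
        then have "\<theta> \<bar>t1 - t2\<bar> + ennreal (L * norm (x - x)) \<le> ennreal \<eta>" by simp
        then have "ennreal (norm (f \<tau> t1 x - f \<tau> t2 x)) \<le> ennreal \<eta>"
          by (rule order_trans[OF osc[OF that(1) s(2)[OF that(3)] s(2)[OF that(3)]]])
        then show ?thesis using \<eta> by (simp add: ennreal_le_iff)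
      qed
      then show ?thesis using h(1) by blast
    qed
    show "\<exists>T0>0. \<forall>T\<ge>T0. \<forall>\<tau>\<ge>0. \<forall>t x. norm x \<le> r \<longrightarrow>
          norm ((1 / T) *\<^sub>R integral {\<tau>..T + \<tau>} (\<lambda>s. f s t x) - fhat (t, x)) \<le> \<gamma>"
      if \<gamma>: "\<gamma> > 0" for \<gamma>
    proof -
      obtain T0 where T0: "\<forall>T\<ge>T0. \<forall>p\<in>{0..} \<times> UNIV \<times> {x. norm x \<le> s}.
          dist (case p of (\<tau>, t, x) \<Rightarrow> (1 / T) *\<^sub>R integral {\<tau>..T + \<tau>} (\<lambda>s. f s t x))
            (case p of (\<tau>, t, x) \<Rightarrow> fhat (t, x)) < \<gamma>"
        using d[OF s(1), unfolded uniform_limit_iff eventually_at_top_linorder] \<gamma> by blast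
      have "dist ((1 / T) *\<^sub>R integral {\<tau>..T + \<tau>} (\<lambda>s. f s t x)) (fhat (t, x)) < \<gamma>"
        if "T \<ge> T0" "\<tau> \<ge> 0" "norm x \<le> s" for T \<tau> t x
        using T0[rule_format, OF that(1), of "(\<tau>, t, x)"] that by simp
      then show ?thesis using s(2)
        by (intro exI[of _ "max T0 1"]) (auto simp: dist_norm intro: less_imp_le)
    qed
  qed
  interpret averaging_attractor f fhat d\<Omega> A
    using av hull_metric attractor projection
    by (simp add: averaging_attractor_def averaging_attractor_axioms_def)
  \<comment> \<open>The base point of the witness is within \<open>\<delta>\<close>, so its state
    belongs to the inflated fiber, and the state distance is below \<open>\<sigma>\<close>.\<close>
  have inflated: "dist_to dist y (inflated_fiber (field_hull fhat) d\<Omega> A \<delta> \<omega>) \<le> ennreal \<sigma>"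
    if nr: "near d\<Omega> A (min \<sigma> \<delta>) \<omega> y" for \<sigma> \<delta> \<omega> y
  proof -
    obtain \<omega>' x' where a: "(\<omega>', x') \<in> A" "d\<Omega> \<omega> \<omega>' < \<delta>" "dist y x' < \<sigma>"
      using nr unfolding near_def by auto
    have "\<omega>' \<in> {\<omega>' \<in> field_hull fhat. d\<Omega> \<omega> \<omega>' \<le> \<delta>}" "x' \<in> fiber A \<omega>'"
      using attractor_subset[OF a(1)] a by (auto simp: fiber_def)
    then have "x' \<in> inflated_fiber (field_hull fhat) d\<Omega> A \<delta> \<omega>"
      unfolding inflated_fiber_def by blast
    then show ?thesis using a(3) by (intro dist_to_le) auto
  qed
  \<comment> \<open>Provides \<open>d\<Omega> \<omega> \<omega> = 0\<close>, by which the fiber over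
    \<open>\<omega>\<close> lies in its inflation by \<open>0\<close>.\<close>
  interpret \<Omega>: Metric_space "field_hull fhat" d\<Omega> by (rule hull_metric(1))
  have exact: "\<exists>\<eta>>0. \<forall>\<omega>\<in>field_hull fhat. \<forall>y. near d\<Omega> A \<eta> \<omega> y \<longrightarrow>
      dist_to dist y (inflated_fiber (field_hull fhat) d\<Omega> A 0 \<omega>) \<le> ennreal \<sigma>"
    if cont: "continuous_map (hull_topology (field_hull fhat)) compacts_topology (fiber A)" and \<sigma>: "\<sigma> > 0" for \<sigma>
  proof -
    \<comment> \<open>Half of \<open>\<sigma>\<close> pays for moving the witness into the fiber
      over \<open>\<omega>\<close>, the other half for its distance from \<open>y\<close>.\<close>
    obtain \<delta> where \<delta>: "\<delta> > 0" "\<And>\<omega> \<omega>' x. \<omega> \<in> field_hull fhat \<Longrightarrow> \<omega>' \<in> field_hull fhat \<Longrightarrow> d\<Omega> \<omega> \<omega>' < \<delta> \<Longrightarrow>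
        x \<in> fiber A \<omega>' \<Longrightarrow> \<exists>y\<in>fiber A \<omega>. dist x y \<le> \<sigma> / 2"
      by (rule fiber_uniformly_close[OF hull_metric(1), unfolded hull_metric(2), OF hull_compact cont half_gt_zero[OF \<sigma>]])
         (rule that)
    have "dist_to dist y (inflated_fiber (field_hull fhat) d\<Omega> A 0 \<omega>) \<le> ennreal \<sigma>"
      if \<omega>: "\<omega> \<in> field_hull fhat" and nr: "near d\<Omega> A (min \<delta> (\<sigma> / 2)) \<omega> y" for \<omega> y
    proof -
      obtain \<omega>' x' where a: "(\<omega>', x') \<in> A" "d\<Omega> \<omega> \<omega>' < \<delta>" "dist y x' < \<sigma> / 2"
        using nr unfolding near_def by auto
      obtain x where x: "x \<in> fiber A \<omega>" "dist x' x \<le> \<sigma> / 2"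
        using \<delta>(2)[OF \<omega> attractor_subset[OF a(1)] a(2), of x'] a(1) by (auto simp: fiber_def)
      have "dist y x \<le> \<sigma>" using dist_triangle[of y x x'] a(3) x(2) by simp
      moreover have "x \<in> inflated_fiber (field_hull fhat) d\<Omega> A 0 \<omega>"
        using x(1) \<omega> by (auto simp: inflated_fiber_def)
      ultimately show ?thesis by (intro dist_to_le)
    qed
    then show ?thesis using \<delta>(1) \<sigma> by (intro exI[of _ "min \<delta> (\<sigma> / 2)"]) auto
  qed
  show ?thesis
  proof (rule conjI; (rule impI)?; intro allI impI)
    fix \<sigma> \<delta> :: real assume "\<sigma> > 0" "\<delta> > 0"
    then have "min \<sigma> \<delta> > 0" by simp
    from averaged_solutions_track[OF basin this, where S = "inflated_fiber (field_hull fhat) d\<Omega> A \<delta>", OF inflated]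
    show "\<exists>t0>0. \<exists>\<epsilon>0>0. \<forall>\<epsilon>. 0 < \<epsilon> \<and> \<epsilon> < \<epsilon>0 \<longrightarrow>
       ({0..} \<subseteq> max_dom {0..} (slow_rhs f \<epsilon>) 0 xhat \<and>
        (\<forall>t\<ge>t0. dist_to dist (max_sol {0..} (slow_rhs f \<epsilon>) 0 xhat t)
                  (inflated_fiber (field_hull fhat) d\<Omega> A \<delta> (shift fhat t)) \<le> ennreal \<sigma>)) \<and>
       ({0..} \<subseteq> max_dom {0..} (fast_rhs f \<epsilon>) 0 xhat \<and>
        (\<forall>\<tau>\<ge>t0 / \<epsilon>. dist_to dist (max_sol {0..} (fast_rhs f \<epsilon>) 0 xhat \<tau>)
                  (inflated_fiber (field_hull fhat) d\<Omega> A \<delta> (shift fhat (\<epsilon> * \<tau>))) \<le> ennreal \<sigma>))" .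
  next
    fix \<sigma> :: real
    assume cont: "continuous_map (hull_topology (field_hull fhat)) compacts_topology (fiber A)" and \<sigma>: "\<sigma> > 0"
    obtain \<eta> where \<eta>: "\<eta> > 0" "\<And>\<omega> y. \<omega> \<in> field_hull fhat \<Longrightarrow> near d\<Omega> A \<eta> \<omega> y \<Longrightarrow>
        dist_to dist y (inflated_fiber (field_hull fhat) d\<Omega> A 0 \<omega>) \<le> ennreal \<sigma>"
      using exact[OF cont \<sigma>] by blast
    from averaged_solutions_track[OF basin \<eta>(1), where S = "inflated_fiber (field_hull fhat) d\<Omega> A 0", OF \<eta>(2)]
    show "\<exists>t0>0. \<exists>\<epsilon>0>0. \<forall>\<epsilon>. 0 < \<epsilon> \<and> \<epsilon> < \<epsilon>0 \<longrightarrow>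
       ({0..} \<subseteq> max_dom {0..} (slow_rhs f \<epsilon>) 0 xhat \<and>
        (\<forall>t\<ge>t0. dist_to dist (max_sol {0..} (slow_rhs f \<epsilon>) 0 xhat t)
                  (inflated_fiber (field_hull fhat) d\<Omega> A 0 (shift fhat t)) \<le> ennreal \<sigma>)) \<and>
       ({0..} \<subseteq> max_dom {0..} (fast_rhs f \<epsilon>) 0 xhat \<and>
        (\<forall>\<tau>\<ge>t0 / \<epsilon>. dist_to dist (max_sol {0..} (fast_rhs f \<epsilon>) 0 xhat \<tau>)
                  (inflated_fiber (field_hull fhat) d\<Omega> A 0 (shift fhat (\<epsilon> * \<tau>))) \<le> ennreal \<sigma>))" .
  qed
qed

end
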